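(* Let $\mathbb{M}(U,\tau)$ be a special Moufang set with $U$ abelian, with $\tau=\mu_e$ for some fixed $e\in U^\#$, and let $H$ be its Hua subgroup and $\mathscr{C}$ its centroid. Suppose that there is a subfield $\Bbbk$ of $\mathrm{End}_H(U)$ with (i) $\dim_\Bbbk U<\infty$, (ii) $|\Bbbk\cap\mathscr{C}|=\infty$, (iii) $U$ is generated by the set $\{eh_a\mid a\in U^\#\}$ as an $\mathrm{End}_H(U)$-module, and (iv) there is $\lambda\in\Bbbk^*\cap\mathscr{C}$ such that $\lambda-1\in\Bbbk^*\cap\mathscr{C}$ as well. Then $(U,\mathscr{H},e)$ is a quadratic Jordan division algebra.
   Context: Maps act on the right and are composed from left to right; $g^h=h^{-1}gh$. A Moufang set consists of a set $X$ with $|X|\ge 3$ and a family $(U_x)_{x\in X}$ of subgroups of $\mathrm{Sym}(X)$ such that each $U_x$ fixes $x$ and acts regularly on $X\setminus\{x\}$, and $U_x^g=U_{xg}$ for all $x,y\in X$ and $g\in U_y$. Construction $\mathbb{M}(U,\tau)$: let $(U,+)$ be a group with $|U|>1$, $U^\#=U\setminus\{0\}$, $X=U\,\dot\cup\,\{\infty\}$, and $\tau\in\mathrm{Sym}(X)$ interchanging $0$ and $\infty$. For $a\in U$ let $\alpha_a:X\to X$, $x\mapsto x+a$ for $x\in U$, $\infty\mapsto\infty$. Set $U_\infty=\{\alpha_a\mid a\in U\}$, $U_0=U_\infty^\tau$, $U_a=U_0^{\alpha_a}$ for $a\in U$, and $\mathbb{M}(U,\tau)=(X,(U_x)_{x\in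 X})$; saying that $\mathbb{M}(U,\tau)$ is a Moufang set is a condition on $(U,\tau)$. For $a\in U^\#$ the $\mu$-map is $\mu_a=\alpha_a\,\alpha_{-(a\tau^{-1})}^{\tau}\,\alpha_{-((-(a\tau^{-1}))\tau)}$ and the Hua map is $h_a=\tau\mu_a$ (for a Moufang set $h_a$ fixes $0,\infty$ and restricts to an automorphism of $U$; $\mu_a$ depends only on the Moufang set). The Hua subgroup is $H=\langle\mu_a\mu_b\mid a,b\in U^\#\rangle$, acting on $U$ by automorphisms. The Moufang set is special if $(-a)\tau=-(a\tau)$ for all $a\in U^\#$. Let $U$ be abelian, $\mathbb{M}(U,\tau)$ special and $\tau=\mu_e$. Set $h_0$ to be the zero map of $U$ and $\mathscr{H}:U\to\mathrm{End}(U)$, $a\mapsto h_a$. $\mathrm{End}_H(U)$ is the ring of endomorphisms of the abelian group $U$ commuting with $H$. The centroid is $\mathscr{C}=\{T\in\mathrm{End}_H(U)\mid h_{aT}=T^2h_a\text{ for all }a\in U\}$. $\Bbbk^*$ denotes the nonzero elements of the (commutative) field $\Bbbk$. Either $U$ is torsion-free and uniquely divisible or an elementary abelian $p$-group for a prime $p$; its prime field is $\mathbb{Q}$ or $\mathbb{F}_p$ respectively, and $U$ is a vector space over it. Quadratic Jordan division algebra: for a field $K$, a $K$-vector space $J$, a map $Q:J\to\mathrm{End}_K(J)$, $a\mapsto Q_a$, and $1\in J\setminus\{0\}$, the triple $(J,Q,1)$ is a quadratic Jordan division algebra over $K$ if: (1) $Q_{r\cdot a}=r^2\cdot Q_a$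 for all $r\in K$, $a\in J$, and $(a,b)\mapsto Q_{a,b}:=Q_{a+b}-Q_a-Q_b$ is $K$-bilinear; (2) $Q_a$ is invertible for all $a\neq 0$; (3) for all $a,b\in J$: $Q_1=\mathrm{id}$; $Q_aV_{a,b}=V_{b,a}Q_a$, where $cV_{a,b}:=bQ_{a,c}$ for $c\in J$; and $Q_{aQ_b}=Q_bQ_aQ_b$. The assertion that $(U,\mathscr{H},e)$ is a quadratic Jordan division algebra is with $U$ as a vector space over its prime field (with $Q=\mathscr{H}$ and $e$ in the role of $1$). *)

theory Defs
  imports "HOL-Algebra.Bij" "HOL-Algebra.Generated_Groups" "HOL-Algebra.Subrings"
    "HOL-Algebra.Module" "HOL-Number_Theory.Residues"
begin

text \<open>
  Permutations act on the right in the mathematical text, so a product \<open>g h\<close> there (first \<open>g\<close>,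
  then \<open>h\<close>) is the function \<open>h \<circ> g\<close> here. The group \<open>BijGroup UNIV\<close> multiplies in the opposite
  order; this does not affect which sets are subgroups, nor generated subgroups.
\<close>

definition perm_conj :: "('x \<Rightarrow> 'x) \<Rightarrow> ('x \<Rightarrow> 'x) \<Rightarrow> 'x \<Rightarrow> 'x"
  where "perm_conj g h = h \<circ> g \<circ> inv_into UNIV h"  \<comment> \<open>\<open>g\<^sup>h = h\<^sup>-\<^sup>1 g h\<close>\<close>

text \<open>The underlying set of a Moufang set is the whole type \<open>'x\<close>; the first conjunct is \<open>|X| \<ge> 3\<close>.\<close>

definition moufang_set :: "('x \<Rightarrow> ('x \<Rightarrow> 'x) set) \<Rightarrow> bool"
  where "moufang_set V \<longleftrightarrow>
    (\<exists>x y z :: 'x. x \<noteq> y \<and> x \<noteq> z \<and> y \<noteq> z) \<and>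
    (\<forall>x. subgroup (V x) (BijGroup UNIV)) \<and>
    (\<forall>x. \<forall>u\<in>V x. u x = x) \<and>
    (\<forall>x y z. y \<noteq> x \<longrightarrow> z \<noteq> x \<longrightarrow> (\<exists>!u. u \<in> V x \<and> u y = z)) \<and>
    (\<forall>x y. \<forall>g\<in>V y. (\<lambda>u. perm_conj u g) ` V x = V (g x))"


section \<open>The construction \<open>M(U, \<tau>)\<close>\<close>

text \<open>\<open>U\<close> is the type \<open>'a\<close>, and \<open>X = U \<union> {\<infinity>}\<close> is \<open>'a option\<close> with \<open>\<infinity> = None\<close>.\<close>

definition interchanges_0_infty :: "('a::group_add option \<Rightarrow> 'a option) \<Rightarrow> bool"
  where "interchanges_0_infty \<tau> \<longleftrightarrow> bij \<tau> \<and> \<tau> (Some 0) = None \<and> \<tau> None = Some 0"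

definition transl :: "'a::group_add \<Rightarrow> 'a option \<Rightarrow> 'a option"
  where "transl a = map_option (\<lambda>x. x + a)"

text \<open>In the second clause \<open>a = 0\<close> gives \<open>U\<^sub>0\<close> itself, as \<open>transl 0\<close> is the identity.\<close>

fun root_group :: "('a::group_add option \<Rightarrow> 'a option) \<Rightarrow> 'a option \<Rightarrow> ('a option \<Rightarrow> 'a option) set"
  where
    "root_group \<tau> None = range transl"
  | "root_group \<tau> (Some a) =
       (\<lambda>g. perm_conj g (transl a)) ` (\<lambda>g. perm_conj g \<tau>) ` range transl"

text \<open>
  \<open>on_U g x\<close> is meaningful if \<open>g\<close> maps \<open>x \<in> U\<close> into \<open>U\<close>: for \<open>x \<noteq> 0\<close> if \<open>g\<close> interchanges \<open>0\<close>
  and \<open>\<infinity>\<close>, and for all \<open>x\<close> if \<open>g\<close> is a Hua map or an element of the Hua subgroup, as these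
  fix \<open>\<infinity>\<close>.
\<close>

definition on_U :: "('a option \<Rightarrow> 'a option) \<Rightarrow> 'a \<Rightarrow> 'a"
  where "on_U g x = the (g (Some x))"

definition mu_map :: "('a::group_add option \<Rightarrow> 'a option) \<Rightarrow> 'a \<Rightarrow> 'a option \<Rightarrow> 'a option"
  where "mu_map \<tau> a =
    (let b = - on_U (inv_into UNIV \<tau>) a
     in transl (- on_U \<tau> b) \<circ> perm_conj (transl b) \<tau> \<circ> transl a)"

text \<open>The map \<open>\<H>\<close>: the Hua map \<open>h\<^sub>a = \<tau> \<mu>\<^sub>a\<close> on \<open>U\<close> if \<open>a \<noteq> 0\<close>, and the zero map if \<open>a = 0\<close>.\<close>

definition hua :: "('a::group_add option \<Rightarrow> 'a option) \<Rightarrow> 'a \<Rightarrow> 'a \<Rightarrow> 'a"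
  where "hua \<tau> a = (if a = 0 then (\<lambda>_. 0) else on_U (mu_map \<tau> a \<circ> \<tau>))"

definition hua_subgroup :: "('a::group_add option \<Rightarrow> 'a option) \<Rightarrow> ('a option \<Rightarrow> 'a option) set"
  where "hua_subgroup \<tau> =
    generate (BijGroup UNIV) {mu_map \<tau> b \<circ> mu_map \<tau> a | a b. a \<noteq> 0 \<and> b \<noteq> 0}"

definition special :: "('a::group_add option \<Rightarrow> 'a option) \<Rightarrow> bool"
  where "special \<tau> \<longleftrightarrow> (\<forall>a. a \<noteq> 0 \<longrightarrow> on_U \<tau> (- a) = - on_U \<tau> a)"


section \<open>The endomorphism ring and the centroid\<close>

definition End_H_ring ::
    "('a::ab_group_add option \<Rightarrow> 'a option) \<Rightarrow> ('a \<Rightarrow> 'a) ring"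
  where "End_H_ring \<tau> =
    \<lparr>carrier = {T. Modules.additive T \<and> (\<forall>h\<in>hua_subgroup \<tau>. T \<circ> on_U h = on_U h \<circ> T)},
     monoid.mult = \<lambda>S T. T \<circ> S,
     one = id,
     zero = \<lambda>_. 0,
     add = \<lambda>S T x. S x + T x\<rparr>"

definition centroid :: "('a::ab_group_add option \<Rightarrow> 'a option) \<Rightarrow> ('a \<Rightarrow> 'a) set"
  where "centroid \<tau> =
    {T \<in> carrier (End_H_ring \<tau>). \<forall>a. hua \<tau> (T a) = hua \<tau> a \<circ> T \<circ> T}"

text \<open>
  The additive group of \<open>U\<close>, equipped with a scalar action. The ring multiplication and unit that
  the record type requires are dummies: \<open>module\<close> and \<open>submodule\<close> do not refer to them.
\<close>

definition scaled_group :: "('r \<Rightarrow> 'a \<Rightarrow> 'a) \<Rightarrow> ('r, 'a::ab_group_add) module"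
  where "scaled_group s =
    \<lparr>carrier = UNIV, monoid.mult = \<lambda>_ _. 0, one = 0, zero = 0, add = (+), smult = s\<rparr>"

text \<open>\<open>S\<close> generates \<open>U\<close> as a module over \<open>R\<close>, a ring of endomorphisms acting by evaluation.\<close>

definition generates_module :: "('a::ab_group_add \<Rightarrow> 'a) ring \<Rightarrow> 'a set \<Rightarrow> bool"
  where "generates_module R S \<longleftrightarrow>
    (\<lambda>N. submodule N R (scaled_group (\<lambda>T x. T x))) hull S = UNIV"

text \<open>For a field \<open>K\<close> of endomorphisms of \<open>U\<close>: \<open>U\<close> has a finite \<open>K\<close>-basis.\<close>

definition finite_dim_over :: "('a::ab_group_add \<Rightarrow> 'a) set \<Rightarrow> bool"
  where "finite_dim_over K \<longleftrightarrow>
    (\<exists>B. finite B \<and> (\<forall>u. \<exists>!c. c \<in> B \<rightarrow>\<^sub>E K \<and> u = (\<Sum>b\<in>B. c b b)))"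


section \<open>Quadratic Jordan division algebras\<close>

definition linear_endos :: "('r, 's) ring_scheme \<Rightarrow> ('r, 'a, 't) module_scheme \<Rightarrow> ('a \<Rightarrow> 'a) set"
  where "linear_endos K J =
    {f \<in> carrier J \<rightarrow> carrier J.
      (\<forall>x\<in>carrier J. \<forall>y\<in>carrier J. f (x \<oplus>\<^bsub>J\<^esub> y) = f x \<oplus>\<^bsub>J\<^esub> f y) \<and>
      (\<forall>r\<in>carrier K. \<forall>x\<in>carrier J. f (r \<odot>\<^bsub>J\<^esub> x) = r \<odot>\<^bsub>J\<^esub> f x)}"

text \<open>\<open>quad_polar J Q a b\<close> is \<open>Q\<^sub>a\<^sub>,\<^sub>b\<close> and \<open>quad_V J Q a b\<close> is \<open>V\<^sub>a\<^sub>,\<^sub>b\<close>.\<close>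

definition quad_polar ::
    "('r, 'a, 't) module_scheme \<Rightarrow> ('a \<Rightarrow> 'a \<Rightarrow> 'a) \<Rightarrow> 'a \<Rightarrow> 'a \<Rightarrow> 'a \<Rightarrow> 'a"
  where "quad_polar J Q a b x = Q (a \<oplus>\<^bsub>J\<^esub> b) x \<ominus>\<^bsub>J\<^esub> Q a x \<ominus>\<^bsub>J\<^esub> Q b x"

definition quad_V ::
    "('r, 'a, 't) module_scheme \<Rightarrow> ('a \<Rightarrow> 'a \<Rightarrow> 'a) \<Rightarrow> 'a \<Rightarrow> 'a \<Rightarrow> 'a \<Rightarrow> 'a"
  where "quad_V J Q a b c = quad_polar J Q a c b"

text \<open>Products of operators are again read from left to right in the mathematical text.\<close>

locale quadratic_jordan_division_algebra =
  field K + module K J for K (structure) and J (structure) +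
  fixes Q :: "'c \<Rightarrow> 'c \<Rightarrow> 'c" and e :: 'c
  assumes unit_carrier: "e \<in> carrier J" and unit_nonzero: "e \<noteq> \<zero>\<^bsub>J\<^esub>"
    and Q_linear: "a \<in> carrier J \<Longrightarrow> Q a \<in> linear_endos K J"
    and Q_smult: "\<lbrakk>r \<in> carrier K; a \<in> carrier J; x \<in> carrier J\<rbrakk> \<Longrightarrow>
      Q (r \<odot>\<^bsub>J\<^esub> a) x = (r \<otimes>\<^bsub>K\<^esub> r) \<odot>\<^bsub>J\<^esub> Q a x"
    and polar_add_left:
      "\<lbrakk>a \<in> carrier J; a' \<in> carrier J; b \<in> carrier J; x \<in> carrier J\<rbrakk> \<Longrightarrow>
       quad_polar J Q (a \<oplus>\<^bsub>J\<^esub> a') b x = quad_polar J Q a b x \<oplus>\<^bsub>J\<^esub> quad_polar J Q a' b x"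
    and polar_smult_left:
      "\<lbrakk>r \<in> carrier K; a \<in> carrier J; b \<in> carrier J; x \<in> carrier J\<rbrakk> \<Longrightarrow>
       quad_polar J Q (r \<odot>\<^bsub>J\<^esub> a) b x = r \<odot>\<^bsub>J\<^esub> quad_polar J Q a b x"
    and polar_add_right:
      "\<lbrakk>a \<in> carrier J; b \<in> carrier J; b' \<in> carrier J; x \<in> carrier J\<rbrakk> \<Longrightarrow>
       quad_polar J Q a (b \<oplus>\<^bsub>J\<^esub> b') x = quad_polar J Q a b x \<oplus>\<^bsub>J\<^esub> quad_polar J Q a b' x"
    and polar_smult_right:
      "\<lbrakk>r \<in> carrier K; a \<in> carrier J; b \<in> carrier J; x \<in> carrier J\<rbrakk> \<Longrightarrow>
       quad_polar J Q a (r \<odot>\<^bsub>J\<^esub> b) x = r \<odot>\<^bsub>J\<^esub> quad_polar J Q a b x"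
    and Q_invertible: "\<lbrakk>a \<in> carrier J; a \<noteq> \<zero>\<^bsub>J\<^esub>\<rbrakk> \<Longrightarrow> bij_betw (Q a) (carrier J) (carrier J)"
    and Q_unit: "x \<in> carrier J \<Longrightarrow> Q e x = x"
    and Q_V_commute: "\<lbrakk>a \<in> carrier J; b \<in> carrier J; x \<in> carrier J\<rbrakk> \<Longrightarrow>
      quad_V J Q a b (Q a x) = Q a (quad_V J Q b a x)"
    and Q_fundamental: "\<lbrakk>a \<in> carrier J; b \<in> carrier J; x \<in> carrier J\<rbrakk> \<Longrightarrow>
      Q (Q b a) x = Q b (Q a (Q b x))"


section \<open>The prime field acting on \<open>U\<close>\<close>

definition int_scale :: "int \<Rightarrow> 'a::ab_group_add \<Rightarrow> 'a"
  where "int_scale k a = a [^]\<^bsub>\<lparr>carrier = UNIV, monoid.mult = (+), one = 0 :: 'a\<rparr>\<^esub> k"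

definition torsion_free_uniquely_divisible :: "'a::ab_group_add itself \<Rightarrow> bool"
  where "torsion_free_uniquely_divisible _ \<longleftrightarrow>
    (\<forall>n>0. \<forall>a::'a. int_scale n a = 0 \<longrightarrow> a = 0) \<and>
    (\<forall>n>0. \<forall>a::'a. \<exists>!b. int_scale n b = a)"

definition elementary_abelian :: "int \<Rightarrow> 'a::ab_group_add itself \<Rightarrow> bool"
  where "elementary_abelian p _ \<longleftrightarrow> (\<forall>a::'a. int_scale p a = 0)"

text \<open>For uniquely divisible \<open>U\<close>: \<open>(m/n) a\<close> is the unique \<open>b\<close> with \<open>n b = m a\<close>.\<close>

definition rat_scale :: "rat \<Rightarrow> 'a::ab_group_add \<Rightarrow> 'a"
  where "rat_scale q a =
    (THE b. int_scale (snd (quotient_of q)) b = int_scale (fst (quotient_of q)) a)"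

definition rat_field :: "rat ring"
  where "rat_field = \<lparr>carrier = UNIV, monoid.mult = (*), one = 1, zero = 0, add = (+)\<rparr>"

end

theory Submission
  imports Defs
begin

text \<open>
  Write \<open>T\<close> for \<open>\<tau>\<close> on \<open>U - {0}\<close>. The \<open>\<mu>\<close>-maps are involutions and expanding
  \<open>\<mu>\<^sub>a\<close> twice gives the identity \<open>h\<^sub>a (T (a + y)) - h\<^sub>y (T (a + y)) = y - a\<close>. Let \<open>C\<close> consist of the
  nonzero elements of \<open>K\<close> in the centroid, so that \<open>h\<^bsub>t y\<^esub> = t\<^sup>2 h\<^sub>y\<close> for \<open>t \<in> C\<close>. The identity
  becomes a linear equation over \<open>K\<close> for \<open>T (c + t y)\<close>, and as \<open>U\<close> has finite dimension, a scalar
  polynomial with constant coefficient 1 times \<open>T (c + t y)\<close> is a polynomial in \<open>t \<in> C\<close>.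

  Applied to \<open>T (s c + t y)\<close>, with \<open>s, t \<in> C\<close>, the identity also determines
  \<open>h\<^bsub>a + t y\<^esub>\<close> on this vector, up to a term involving only \<open>h\<^bsub>s c - a\<^esub>\<close>. Since \<open>C\<close> is infinite, one may
  extract the constant coefficient in \<open>s\<^sup>-\<^sup>1\<close>, which shows that \<open>h\<^bsub>a + t y\<^esub> (T c)\<close> is polynomial in \<open>t\<close>.
  The symmetry \<open>t \<mapsto> t\<^sup>-\<^sup>1\<close> bounds the degree by 2, so the polarisation of \<open>h\<close> is homogeneous over \<open>C\<close>,
  which forces it to be biadditive. The remaining Jordan identity \<open>Q\<^sub>a V\<^bsub>a,b\<^esub> = V\<^bsub>b,a\<^esub> Q\<^sub>a\<close> is the first
  order term of the same identity.
\<close>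

section \<open>Polynomial functions over a field of endomorphisms\<close>

text \<open>The obstacle is that nothing relates h (a + b) to h a and h b directly: the known
  identity compares h a and h y only at the single vector T (a + y). Finite dimension makes it
  possible to move that vector along a line. The equation has the form (1 - t^2 D) v = w with D =
  h_c^{-1} h_y, and a monic P of degree m over \<open>K\<close> with P(D) = 0 makes t^{2m} P(t^{-2})
  times v polynomial in t. Monicity gives this factor the constant coefficient 1, so nothing is lost
  at t = 0. Taking the constant coefficient in s^{-1} replaces the limit in which s c dominates:
  there s T (s c + t y) = T (c + s^{-1} t y) tends to T c. Interpolation on an infinite set needs no
  topology and, being linear over \<open>K\<close>, keeps polynomials in t polynomial.
  \<open>C\<close> is handled only as a multiplicative group, so homogeneity over it is not yet
  linearity; additivity is obtained by expanding the polarisation at b + t c in two ways. That the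
  \<open>mu\<close>-maps are involutions also rests on \<open>K\<close>: doubling is a scalar, hence
  zero or invertible.\<close>

locale operator_field =
  fixes K :: "('a::ab_group_add \<Rightarrow> 'a) set"
  assumes additive_op: "k \<in> K \<Longrightarrow> Modules.additive k"
    and id_closed: "id \<in> K"
    and zero_closed: "(\<lambda>_. 0) \<in> K"
    and add_closed: "\<lbrakk>k \<in> K; l \<in> K\<rbrakk> \<Longrightarrow> (\<lambda>x. k x + l x) \<in> K"
    and minus_closed: "k \<in> K \<Longrightarrow> (\<lambda>x. - k x) \<in> K"
    and comp_closed: "\<lbrakk>k \<in> K; l \<in> K\<rbrakk> \<Longrightarrow> k \<circ> l \<in> K"
    and commute: "\<lbrakk>k \<in> K; l \<in> K\<rbrakk> \<Longrightarrow> k (l x) = l (k x)"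
    and inverse_exists: "\<lbrakk>k \<in> K; k \<noteq> (\<lambda>_. 0)\<rbrakk> \<Longrightarrow> \<exists>l\<in>K. \<forall>x. l (k x) = x"
begin

lemma op_add: "k \<in> K \<Longrightarrow> k (x + y) = k x + k y"
  by (meson additive.add additive_op)

lemma op_zero: "k \<in> K \<Longrightarrow> k 0 = 0"
  by (meson additive.zero additive_op)

lemma op_minus: "k \<in> K \<Longrightarrow> k (- x) = - k x"
  by (meson additive.minus additive_op)

lemma op_diff: "k \<in> K \<Longrightarrow> k (x - y) = k x - k y"
  by (meson additive.diff additive_op)

lemma op_sum: "k \<in> K \<Longrightarrow> k (\<Sum>i\<in>A. f i) = (\<Sum>i\<in>A. k (f i))"
  by (rule additive.sum[OF additive_op])

lemmas op_simps = op_add op_zero op_minus op_diff op_sum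

lemma diff_closed: "\<lbrakk>k \<in> K; l \<in> K\<rbrakk> \<Longrightarrow> (\<lambda>x. k x - l x) \<in> K"
  using add_closed[of k "\<lambda>x. - l x"] minus_closed[of l] by simp

lemma sum_closed: "(\<And>i. i \<in> A \<Longrightarrow> k i \<in> K) \<Longrightarrow> (\<lambda>x. \<Sum>i\<in>A. k i x) \<in> K"
  by (induction A rule: infinite_finite_induct) (auto simp: zero_closed intro: add_closed)

lemma pow_closed: "k \<in> K \<Longrightarrow> k ^^ n \<in> K"
  by (induction n) (auto simp: id_closed intro: comp_closed)

definition inv_op :: "('a \<Rightarrow> 'a) \<Rightarrow> 'a \<Rightarrow> 'a"
  where "inv_op k = (SOME l. l \<in> K \<and> (\<forall>x. l (k x) = x))"

lemma
  assumes "k \<in> K" "k \<noteq> (\<lambda>_. 0)"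
  shows inv_op_closed: "inv_op k \<in> K"
    and inv_op_left: "inv_op k (k x) = x"
    and inv_op_right: "k (inv_op k x) = x"
proof -
  have *: "inv_op k \<in> K \<and> (\<forall>x. inv_op k (k x) = x)"
    unfolding inv_op_def by (rule someI_ex[of "\<lambda>l. l \<in> K \<and> (\<forall>x. l (k x) = x)"]) (use inverse_exists[OF assms] in blast)
  then show "inv_op k \<in> K" "inv_op k (k x) = x" by auto
  show "k (inv_op k x) = x" using * commute assms by metis
qed

lemma op_eq_zero_iff: "\<lbrakk>k \<in> K; k \<noteq> (\<lambda>_. 0)\<rbrakk> \<Longrightarrow> k x = 0 \<longleftrightarrow> x = 0"
  by (metis inv_op_closed inv_op_left op_zero)

lemma diff_nonzero: "k \<noteq> (l :: 'a \<Rightarrow> 'a) \<Longrightarrow> (\<lambda>x. k x - l x) \<noteq> (\<lambda>_. 0)"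
proof
  assume "k \<noteq> l" "(\<lambda>x. k x - l x) = (\<lambda>_. 0)"
  then have "k x = l x" for x using fun_cong[of "\<lambda>x. k x - l x" "\<lambda>_. 0" x] by simp
  with \<open>k \<noteq> l\<close> show False by auto
qed

section \<open>Polynomials in a scalar with vector coefficients\<close>

text \<open>The vector \<open>\<Sum>j\<le>n. t\<^sup>j (u j)\<close> in Horner form.\<close>

fun peval :: "nat \<Rightarrow> (nat \<Rightarrow> 'a) \<Rightarrow> ('a \<Rightarrow> 'a) \<Rightarrow> 'a"
  where
    "peval 0 u t = u 0"
  | "peval (Suc n) u t = u 0 + t (peval n (\<lambda>j. u (Suc j)) t)"

lemma peval_zero: "t \<in> K \<Longrightarrow> peval n (\<lambda>_. 0) t = 0"
  by (induction n) (auto simp: op_simps)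

lemma peval_add: "t \<in> K \<Longrightarrow> peval n (\<lambda>j. u j + v j) t = peval n u t + peval n v t"
  by (induction n arbitrary: u v) (auto simp: op_simps algebra_simps)

lemma peval_map:
  assumes "t \<in> K" "Modules.additive f" "\<And>x. f (t x) = t (f x)"
  shows "f (peval n u t) = peval n (\<lambda>j. f (u j)) t"
  using assms by (induction n arbitrary: u) (auto simp: op_simps additive.add)

lemma peval_extend: "t \<in> K \<Longrightarrow> n \<le> m \<Longrightarrow> peval m (\<lambda>j. if j \<le> n then u j else 0) t = peval n u t"
proof (induction n arbitrary: u m)
  case 0
  then show ?case by (cases m) (auto simp: peval_zero op_simps)
next
  case (Suc n)
  then obtain m' where "m = Suc m'" "n \<le> m'" by (cases m) auto
  then show ?case using Suc by auto
qed

lemma peval_dilate: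
  "t \<in> K \<Longrightarrow> s \<in> K \<Longrightarrow> peval n u (t \<circ> s) = peval n (\<lambda>j. (s ^^ j) (u j)) t"
proof (induction n arbitrary: u)
  case (Suc n)
  have "s (peval n v t) = peval n (\<lambda>j. s (v j)) t" for v
    using Suc.prems by (intro peval_map additive_op) (auto intro: commute)
  then show ?case using Suc by (simp add: o_def)
qed simp

text \<open>Division by s - t, with quotient coefficients \<open>v\<close> that depend on
  \<open>t\<close> but not on \<open>s\<close>. The first conjunct is the value at s = 0, in the
  form in which interpolation recovers \<open>u 0\<close> from the value at
  \<open>t\<close>.\<close>

lemma peval_diff_quotient:
  assumes "t \<in> K"
  shows "\<exists>v. t (v 0) = peval (Suc n) u t - u 0 \<and>
    (\<forall>s\<in>K. peval (Suc n) u s - peval (Suc n) u t = s (peval n v s) - t (peval n v s))"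
proof (induction n arbitrary: u)
  case 0
  show ?case by (rule exI[of _ "\<lambda>_. u 1"]) auto
next
  case (Suc n)
  obtain v where v: "\<And>s. s \<in> K \<Longrightarrow> peval (Suc n) (\<lambda>j. u (Suc j)) s - peval (Suc n) (\<lambda>j. u (Suc j)) t =
      s (peval n v s) - t (peval n v s)"
    using Suc.IH by blast
  let ?v = "\<lambda>j. case j of 0 \<Rightarrow> peval (Suc n) (\<lambda>j. u (Suc j)) t | Suc j \<Rightarrow> v j"
  have "peval (Suc (Suc n)) u s - peval (Suc (Suc n)) u t =
      s (peval (Suc n) ?v s) - t (peval (Suc n) ?v s)" if s: "s \<in> K" for s
  proof -
    define g where "g r = peval (Suc n) (\<lambda>j. u (Suc j)) r" for r
    have g: "g s = g t + (s (peval n v s) - t (peval n v s))"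
      using v[OF s] unfolding g_def by (simp add: algebra_simps)
    have "peval (Suc (Suc n)) u s - peval (Suc (Suc n)) u t = s (g s) - t (g t)"
      by (simp add: g_def)
    also have "\<dots> = s (g t + s (peval n v s)) - t (g t + s (peval n v s))"
      unfolding g using s assms by (simp add: op_simps commute[of s t])
    also have "g t + s (peval n v s) = peval (Suc n) ?v s"
      by (simp add: g_def)
    finally show ?thesis .
  qed
  then show ?case by (intro exI[of _ ?v]) auto
qed

section \<open>Interpolation at zero\<close>

text \<open>Lagrange interpolation at \<open>0\<close>: \<open>L\<close> reads off the constant coefficient of a polynomial of
  degree at most \<open>n\<close> from its values on \<open>S\<close>.\<close>

definition extracts :: "('a \<Rightarrow> 'a) set \<Rightarrow> nat \<Rightarrow> ((('a \<Rightarrow> 'a) \<Rightarrow> 'a) \<Rightarrow> 'a) \<Rightarrow> bool"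
  where "extracts S n L \<longleftrightarrow>
    (\<forall>f g. L (\<lambda>s. f s + g s) = L f + L g) \<and>
    (\<forall>k\<in>K. \<forall>f. L (\<lambda>s. k (f s)) = k (L f)) \<and>
    (\<forall>f g. (\<forall>s\<in>S. f s = g s) \<longrightarrow> L f = L g) \<and>
    (\<forall>u. L (peval n u) = u 0)"

text \<open>Newton's scheme: drop a node \<open>t\<close>. The divided difference (f s - f t) / (s -
  t) of a polynomial has degree one less, and p(0) = p(t) - t q(0) for this quotient q. Dependence
  on the values over \<open>S\<close> alone is built into \<open>extracts\<close> because
  \<open>inv_op (d s)\<close> is arbitrary at s = t.\<close>

lemma extracts_exists:
  assumes "infinite S" "S \<subseteq> K"
  shows "\<exists>L. extracts S n L"
  using assms
proof (induction n arbitrary: S)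
  case 0
  then obtain s where "s \<in> S" by (metis finite.emptyI ex_in_conv)
  then show ?case by (intro exI[of _ "\<lambda>g. g s"]) (auto simp: extracts_def)
next
  case (Suc n)
  then obtain t where t: "t \<in> S" by (metis finite.emptyI ex_in_conv)
  then have tK: "t \<in> K" using Suc.prems by auto
  have "infinite (S - {t})" "S - {t} \<subseteq> K" using Suc.prems by auto
  then obtain L where "extracts (S - {t}) n L" using Suc.IH by blast
  then have L_add: "\<And>f g. L (\<lambda>s. f s + g s) = L f + L g"
    and L_op: "\<And>k f. k \<in> K \<Longrightarrow> L (\<lambda>s. k (f s)) = k (L f)"
    and L_cong: "\<And>f g. (\<forall>s\<in>S - {t}. f s = g s) \<Longrightarrow> L f = L g"
    and L_peval: "\<And>u. L (peval n u) = u 0"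
    unfolding extracts_def by blast+
  define d where "d s = (\<lambda>x. s x - t x)" for s :: "'a \<Rightarrow> 'a"
  have d: "d s \<in> K" "d s \<noteq> (\<lambda>_. 0)" if "s \<in> S - {t}" for s
    using that Suc.prems tK diff_nonzero[of s t] by (auto simp: d_def intro: diff_closed)
  define q where "q f = (\<lambda>s. inv_op (d s) (f s - f t))" for f :: "('a \<Rightarrow> 'a) \<Rightarrow> 'a"
  define L' where "L' f = f t - t (L (q f))" for f
  have "L (q (\<lambda>s. f s + g s)) = L (q f) + L (q g)" for f g
  proof -
    have "L (q (\<lambda>s. f s + g s)) = L (\<lambda>s. q f s + q g s)"
    proof (rule L_cong, rule ballI)
      fix s assume s: "s \<in> S - {t}"
      have "f s + g s - (f t + g t) = (f s - f t) + (g s - g t)" by (simp add: algebra_simps)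
      then show "q (\<lambda>s. f s + g s) s = q f s + q g s"
        using op_add[OF inv_op_closed[OF d[OF s]]] by (simp only: q_def)
    qed
    then show ?thesis by (simp add: L_add)
  qed
  then have 1: "L' (\<lambda>s. f s + g s) = L' f + L' g" for f g
    using tK by (simp add: L'_def op_simps)
  have 2: "L' (\<lambda>s. k (f s)) = k (L' f)" if k: "k \<in> K" for k f
  proof -
    have "L (q (\<lambda>s. k (f s))) = L (\<lambda>s. k (q f s))"
    proof (rule L_cong, rule ballI)
      fix s assume s: "s \<in> S - {t}"
      show "q (\<lambda>s. k (f s)) s = k (q f s)"
        using inv_op_closed[OF d[OF s]] k by (simp add: q_def op_simps commute[of k])
    qed
    then show ?thesis using k tK by (simp add: L'_def op_simps L_op commute[of k t])
  qed
  have 3: "L' f = L' g" if "\<forall>s\<in>S. f s = g s" for f g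
  proof -
    have "L (q f) = L (q g)" using that t by (intro L_cong) (auto simp: q_def)
    then show ?thesis using that t by (simp add: L'_def)
  qed
  have 4: "L' (peval (Suc n) u) = u 0" for u
  proof -
    obtain v where v0: "t (v 0) = peval (Suc n) u t - u 0"
      and v: "\<And>s. s \<in> K \<Longrightarrow> peval (Suc n) u s - peval (Suc n) u t = s (peval n v s) - t (peval n v s)"
      using peval_diff_quotient[OF tK] by blast
    have "L (q (peval (Suc n) u)) = L (peval n v)"
    proof (rule L_cong, rule ballI)
      fix s assume s: "s \<in> S - {t}"
      then have "s \<in> K" using Suc.prems by auto
      show "q (peval (Suc n) u) s = peval n v s"
        unfolding q_def v[OF \<open>s \<in> K\<close>] using inv_op_left[OF d[OF s], of "peval n v s"] by (simp add: d_def)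
    qed
    then show ?thesis using v0 by (simp add: L'_def L_peval del: peval.simps)
  qed
  show ?case using 1 2 3 4 by (intro exI[of _ L']) (auto simp: extracts_def)
qed

lemma
  assumes "extracts S n L"
  shows extracts_add: "L (\<lambda>s. f s + g s) = L f + L g"
    and extracts_op: "k \<in> K \<Longrightarrow> L (\<lambda>s. k (f s)) = k (L f)"
    and extracts_cong: "(\<And>s. s \<in> S \<Longrightarrow> f s = g s) \<Longrightarrow> L f = L g"
    and extracts_const: "L (peval n u) = u 0"
  using assms unfolding extracts_def by blast+

lemma extracts_zero: "extracts S n L \<Longrightarrow> L (\<lambda>_. 0) = 0"
  using extracts_op[OF _ zero_closed] by blast

text \<open>An operation on functions of \<open>s\<close> thereby acts coefficientwise on
  polynomials in \<open>t\<close>. A single bound \<open>m\<close> on the degree in \<open>t\<close>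
  has to serve every \<open>s\<close>.\<close>

lemma extracts_peval:
  assumes L: "extracts S n L" and t: "t \<in> K"
  shows "L (\<lambda>s. peval m (z s) t) = peval m (\<lambda>j. L (\<lambda>s. z s j)) t"
  by (induction m arbitrary: z) (simp_all add: extracts_add[OF L] extracts_op[OF L t])

text \<open>Interpolation shows that the constant coefficient is zero. What remains is
  \<open>s\<close> times a polynomial of lower degree, which vanishes on \<open>S\<close> without
  the zero scalar.\<close>

lemma peval_vanishing:
  assumes "infinite S" "S \<subseteq> K" "\<And>s. s \<in> S \<Longrightarrow> peval n u s = 0" "j \<le> n"
  shows "u j = 0"
  using assms
proof (induction n arbitrary: S u j)
  case 0
  then show ?case by (metis ex_in_conv finite.emptyI le_zero_eq peval.simps(1))
next
  case (Suc n)
  obtain L where L: "extracts S (Suc n) L" using extracts_exists Suc.prems by blast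
  have "L (peval (Suc n) u) = L (\<lambda>_. 0)" using Suc.prems(3) by (rule extracts_cong[OF L])
  then have u0: "u 0 = 0" unfolding extracts_const[OF L] extracts_zero[OF L] .
  have "peval n (\<lambda>j. u (Suc j)) s = 0" if "s \<in> S - {\<lambda>_. 0}" for s
    using Suc.prems(2) Suc.prems(3)[of s] that u0 op_eq_zero_iff[of s] by auto
  then have "u (Suc i) = 0" if "i \<le> n" for i
    using Suc.IH[of "S - {\<lambda>_. 0}" "\<lambda>j. u (Suc j)" i] Suc.prems(1,2) that by auto
  with u0 show ?case using Suc.prems(4) by (cases j) auto
qed

section \<open>Polynomial functions of a scalar\<close>

definition poly_fun :: "nat \<Rightarrow> (('a \<Rightarrow> 'a) \<Rightarrow> 'a) \<Rightarrow> bool"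
  where "poly_fun n g \<longleftrightarrow> (\<exists>u. \<forall>t\<in>K. g t = peval n u t)"

lemma poly_fun_mono: "poly_fun n g \<Longrightarrow> n \<le> m \<Longrightarrow> poly_fun m g"
proof -
  assume "poly_fun n g" "n \<le> m"
  then obtain u where "\<forall>t\<in>K. g t = peval n u t" by (auto simp: poly_fun_def)
  with \<open>n \<le> m\<close> show ?thesis unfolding poly_fun_def
    by (intro exI[of _ "\<lambda>j. if j \<le> n then u j else 0"]) (simp add: peval_extend)
qed

lemma poly_fun_const: "poly_fun n (\<lambda>_. x)"
proof -
  have "poly_fun 0 (\<lambda>_. x)" unfolding poly_fun_def by auto
  then show ?thesis by (rule poly_fun_mono) simp
qed

lemma poly_fun_add: "poly_fun n f \<Longrightarrow> poly_fun n g \<Longrightarrow> poly_fun n (\<lambda>t. f t + g t)"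
proof -
  assume "poly_fun n f" "poly_fun n g"
  then obtain u v where "\<forall>t\<in>K. f t = peval n u t" "\<forall>t\<in>K. g t = peval n v t"
    by (auto simp: poly_fun_def)
  then show ?thesis unfolding poly_fun_def
    by (intro exI[of _ "\<lambda>j. u j + v j"]) (simp add: peval_add)
qed

lemma poly_fun_mult: "poly_fun n g \<Longrightarrow> poly_fun (Suc n) (\<lambda>t. t (g t))"
proof -
  assume "poly_fun n g"
  then obtain u where "\<forall>t\<in>K. g t = peval n u t" by (auto simp: poly_fun_def)
  then show ?thesis unfolding poly_fun_def
    by (intro exI[of _ "\<lambda>j. if j = 0 then 0 else u (j - 1)"]) simp
qed

lemma poly_fun_map:
  assumes "poly_fun n g" "Modules.additive f" "\<And>t x. t \<in> K \<Longrightarrow> f (t x) = t (f x)"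
  shows "poly_fun n (\<lambda>t. f (g t))"
proof -
  obtain u where "\<forall>t\<in>K. g t = peval n u t" using assms(1) by (auto simp: poly_fun_def)
  then show ?thesis
    unfolding poly_fun_def using peval_map[OF _ assms(2)] assms(3) by (intro exI[of _ "\<lambda>j. f (u j)"]) auto
qed

lemma poly_fun_op: "poly_fun n g \<Longrightarrow> k \<in> K \<Longrightarrow> poly_fun n (\<lambda>t. k (g t))"
  by (rule poly_fun_map) (auto intro: additive_op commute)

lemma poly_fun_minus: "poly_fun n g \<Longrightarrow> poly_fun n (\<lambda>t. - g t)"
  using poly_fun_op[of n g "\<lambda>x. - x"] minus_closed[OF id_closed] by simp

lemma poly_fun_diff: "poly_fun n f \<Longrightarrow> poly_fun n g \<Longrightarrow> poly_fun n (\<lambda>t. f t - g t)"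
  using poly_fun_add[of n f "\<lambda>t. - g t"] poly_fun_minus[of n g] by simp

lemma poly_fun_sum:
  "(\<And>i. i \<in> A \<Longrightarrow> poly_fun n (f i)) \<Longrightarrow> poly_fun n (\<lambda>t. \<Sum>i\<in>A. f i t)"
  by (induction A rule: infinite_finite_induct) (auto simp: poly_fun_const intro: poly_fun_add)

lemma poly_fun_dilate:
  assumes "poly_fun n g" "s \<in> K"
  shows "poly_fun n (\<lambda>t. g (t \<circ> s))"
proof -
  obtain u where "\<forall>t\<in>K. g t = peval n u t" using assms(1) by (auto simp: poly_fun_def)
  then show ?thesis
    unfolding poly_fun_def using assms(2) comp_closed peval_dilate
    by (intro exI[of _ "\<lambda>j. (s ^^ j) (u j)"]) auto
qed

section \<open>Monic relations from finite dimension\<close>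

text \<open>Induction on \<open>I\<close>: two relations on the smaller index set with different leading terms
  have a combination that also vanishes at the new index.\<close>

lemma monic_relation:
  assumes "finite I" "\<And>j i. i \<in> I \<Longrightarrow> f j i \<in> K"
  shows "\<exists>m k. (\<forall>j. k j \<in> K) \<and> k m = id \<and> (\<forall>i\<in>I. \<forall>x. (\<Sum>j\<le>m. k j (f (j::nat) i x)) = 0)"
  using assms
proof (induction I arbitrary: f rule: finite_induct)
  case empty
  show ?case
    by (rule exI[of _ 0], rule exI[of _ "\<lambda>_. id"], intro conjI allI) (use id_closed in \<open>blast, simp_all\<close>)
next
  case (insert i I)
  have fI: "f j i' \<in> K" if "i' \<in> I" for j i' using insert.prems that by auto
  have fi: "f j i \<in> K" for j using insert.prems by auto
  obtain m k where k: "\<And>j. k j \<in> K" "k m = id" "\<And>i' x. i' \<in> I \<Longrightarrow> (\<Sum>j\<le>m. k j (f j i' x)) = 0"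
    using insert.IH[of f] fI by blast
  define c where "c x = (\<Sum>j\<le>m. k j (f j i x))" for x
  have cK: "c \<in> K" unfolding c_def
    using sum_closed[of "{..m}" "\<lambda>j. k j \<circ> f j i"] k(1) fi by (auto intro: comp_closed)
  show ?case
  proof (cases "c = (\<lambda>_. 0)")
    case True
    then have "(\<Sum>j\<le>m. k j (f j i x)) = 0" for x unfolding c_def by meson
    then show ?thesis using k by blast
  next
    case False
    \<comment> \<open>The second relation is taken for the sequence shifted by \<open>Suc m\<close>:
      the index ranges of the two relations are then disjoint, and subtracting a multiple of the
      first leaves the leading coefficient \<open>id\<close> intact.\<close>
    have "\<exists>m' k'. (\<forall>j. k' j \<in> K) \<and> k' m' = id \<and>
        (\<forall>i\<in>I. \<forall>x. (\<Sum>j\<le>m'. k' j (f (j + Suc m) i x)) = 0)"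
      by (rule insert.IH) (rule fI)
    then obtain m' k' where k': "\<And>j. k' j \<in> K" "k' m' = id"
      "\<forall>i'\<in>I. \<forall>x. (\<Sum>j\<le>m'. k' j (f (j + Suc m) i' x)) = 0"
      by blast
    define c' where "c' x = (\<Sum>j\<le>m'. k' j (f (j + Suc m) i x))" for x
    have c'K: "c' \<in> K" unfolding c'_def
      using sum_closed[of "{..m'}" "\<lambda>j. k' j \<circ> f (j + Suc m) i"] k'(1) fi by (auto intro: comp_closed)
    define r where "r = c' \<circ> inv_op c"
    have rK: "r \<in> K" unfolding r_def using cK c'K False inv_op_closed comp_closed by blast
    define l where "l j = (if j \<le> m then (\<lambda>x. - r (k j x)) else k' (j - Suc m))" for j
    have lK: "l j \<in> K" for j
      unfolding l_def using rK k(1) k'(1) minus_closed[of "r \<circ> k j"] comp_closed[of r "k j"] by auto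
    have split: "(\<Sum>j\<le>m' + Suc m. l j (g j)) =
        - r (\<Sum>j\<le>m. k j (g j)) + (\<Sum>j\<le>m'. k' j (g (j + Suc m)))" for g
    proof -
      have "{..m' + Suc m} = {..m} \<union> {Suc m..m' + Suc m}" by auto
      then have "(\<Sum>j\<le>m' + Suc m. l j (g j)) =
          (\<Sum>j\<le>m. l j (g j)) + (\<Sum>j\<in>{Suc m..m' + Suc m}. l j (g j))"
        by (simp add: sum.union_disjoint)
      also have "(\<Sum>j\<le>m. l j (g j)) = - r (\<Sum>j\<le>m. k j (g j))"
        using rK by (simp add: l_def op_simps sum_negf)
      also have "(\<Sum>j\<in>{Suc m..m' + Suc m}. l j (g j)) = (\<Sum>j\<in>{0..m'}. l (j + Suc m) (g (j + Suc m)))"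
        using sum.shift_bounds_cl_nat_ivl[of "\<lambda>j. l j (g j)" 0 "Suc m" m'] by simp
      also have "\<dots> = (\<Sum>j\<le>m'. k' j (g (j + Suc m)))"
        by (simp add: l_def atMost_atLeast0)
      finally show ?thesis .
    qed
    have "(\<Sum>j\<le>m' + Suc m. l j (f j i' x)) = 0" if "i' \<in> insert i I" for i' x
    proof (cases "i' = i")
      case True
      have "(\<Sum>j\<le>m' + Suc m. l j (f j i x)) = - r (c x) + c' x"
        unfolding split c_def c'_def ..
      then show ?thesis using True cK c'K False by (simp add: r_def inv_op_left)
    next
      case False
      then have "i' \<in> I" using that by simp
      then show ?thesis unfolding split using k(3) k'(3) rK by (simp add: op_simps)
    qed
    moreover have "l (m' + Suc m) = id" using k'(2) by (simp add: l_def)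
    ultimately show ?thesis using lK by blast
  qed
qed

text \<open>A substitute for Cayley-Hamilton without a bound on the degree: in a basis, the powers
  of \<open>D\<close> have finitely many matrix entries, each a sequence in \<open>K\<close>, and
  \<open>monic_relation\<close> gives one relation valid for all of them.\<close>

lemma monic_annihilator:
  assumes "finite_dim_over K" and D: "Modules.additive D" and comm: "\<And>k x. k \<in> K \<Longrightarrow> D (k x) = k (D x)"
  shows "\<exists>m k. (\<forall>j. k j \<in> K) \<and> k m = id \<and> (\<forall>x. (\<Sum>j\<le>m. k j ((D ^^ j) x)) = 0)"
proof -
  obtain B where "finite B" and B: "\<forall>u. \<exists>!c. c \<in> B \<rightarrow>\<^sub>E K \<and> u = (\<Sum>b\<in>B. c b b)"
    using assms(1) unfolding finite_dim_over_def by (elim exE conjE)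
  define c where "c u = (THE c. c \<in> B \<rightarrow>\<^sub>E K \<and> u = (\<Sum>b\<in>B. c b b))" for u
  have c: "c u \<in> B \<rightarrow>\<^sub>E K" "u = (\<Sum>b\<in>B. c u b b)" for u
    using theI'[OF spec[OF B]] unfolding c_def by (rule conjunct1, rule conjunct2)
  have cK: "c u b \<in> K" if "b \<in> B" for u b using c(1) that by (auto simp: PiE_def Pi_def)
  obtain m k where k: "\<And>j. k j \<in> K" "k m = id"
    "\<forall>i\<in>B \<times> B. \<forall>x. (\<Sum>j\<le>m. k j (c ((D ^^ j) (fst i)) (snd i) x)) = 0"
  proof -
    have "\<exists>m k. (\<forall>j. k j \<in> K) \<and> k m = id \<and>
        (\<forall>i\<in>B \<times> B. \<forall>x. (\<Sum>j\<le>m. k j (c ((D ^^ j) (fst i)) (snd i) x)) = 0)"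
      using \<open>finite B\<close> cK by (intro monic_relation) auto
    then show ?thesis using that by blast
  qed
  have Dj: "Modules.additive (D ^^ j)" "\<And>k x. k \<in> K \<Longrightarrow> (D ^^ j) (k x) = k ((D ^^ j) x)" for j
    using D comm by (induction j) (auto simp: Modules.additive_def)
  have b: "(\<Sum>j\<le>m. k j ((D ^^ j) b)) = 0" if "b \<in> B" for b
  proof -
    have "(\<Sum>j\<le>m. k j ((D ^^ j) b)) = (\<Sum>j\<le>m. k j (\<Sum>b'\<in>B. c ((D ^^ j) b) b' b'))"
    proof (rule sum.cong[OF refl])
      fix j
      show "k j ((D ^^ j) b) = k j (\<Sum>b'\<in>B. c ((D ^^ j) b) b' b')"
        by (rule arg_cong[where f = "k j"]) (rule c(2))
    qed
    also have "\<dots> = (\<Sum>b'\<in>B. \<Sum>j\<le>m. k j (c ((D ^^ j) b) b' b'))"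
      unfolding op_sum[OF k(1)] by (rule sum.swap)
    also have "\<dots> = 0" using bspec[OF k(3), of "(b, _)"] that by simp
    finally show ?thesis .
  qed
  have "(\<Sum>j\<le>m. k j ((D ^^ j) x)) = 0" for x
  proof -
    have "(\<Sum>j\<le>m. k j ((D ^^ j) x)) = (\<Sum>j\<le>m. k j ((D ^^ j) (\<Sum>b\<in>B. c x b b)))"
      by (rule arg_cong[where f = "\<lambda>y. \<Sum>j\<le>m. k j ((D ^^ j) y)"]) (rule c(2))
    also have "\<dots> = (\<Sum>j\<le>m. \<Sum>b\<in>B. c x b (k j ((D ^^ j) b)))"
    proof (intro sum.cong refl)
      fix j
      have "(D ^^ j) (\<Sum>b\<in>B. c x b b) = (\<Sum>b\<in>B. c x b ((D ^^ j) b))"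
        unfolding additive.sum[OF Dj(1)] using Dj(2) cK by (intro sum.cong) auto
      then show "k j ((D ^^ j) (\<Sum>b\<in>B. c x b b)) = (\<Sum>b\<in>B. c x b (k j ((D ^^ j) b)))"
        using commute[OF k(1) cK] by (simp add: op_sum[OF k(1)])
    qed
    also have "\<dots> = (\<Sum>b\<in>B. c x b (\<Sum>j\<le>m. k j ((D ^^ j) b)))"
      by (subst sum.swap, intro sum.cong refl) (simp add: op_sum[OF cK])
    also have "\<dots> = 0" using b op_zero[OF cK] by simp
    finally show ?thesis .
  qed
  then show ?thesis using k(1,2) by blast
qed

section \<open>Shifting and reversing coefficients\<close>

lemma peval_at_zero: "peval n u (\<lambda>_. 0) = u 0"
  by (cases n) auto

lemma peval_sum: "t \<in> K \<Longrightarrow> peval n u t = (\<Sum>j\<le>n. (t ^^ j) (u j))"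
proof (induction n arbitrary: u)
  case (Suc n)
  have "(\<Sum>j\<le>Suc n. (t ^^ j) (u j)) = u 0 + (\<Sum>j\<le>n. (t ^^ Suc j) (u (Suc j)))"
    by (subst sum.atMost_Suc_shift) simp
  also have "\<dots> = u 0 + t (\<Sum>j\<le>n. (t ^^ j) (u (Suc j)))"
    using Suc.prems by (simp add: op_simps)
  finally show ?case using Suc by simp
qed simp

lemma peval_shift_pow:
  "t \<in> K \<Longrightarrow> (t ^^ k) (peval n u t) = peval (n + k) (\<lambda>j. if j < k then 0 else u (j - k)) t"
proof (induction k)
  case (Suc k)
  have "(t ^^ Suc k) (peval n u t) = t (peval (n + k) (\<lambda>j. if j < k then 0 else u (j - k)) t)"
    using Suc by simp
  also have "\<dots> = peval (n + Suc k) (\<lambda>j. if j < Suc k then 0 else u (j - Suc k)) t"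
    by (simp cong: if_cong)
  finally show ?case .
qed simp

lemma peval_reverse:
  assumes t: "t \<in> K" "t \<noteq> (\<lambda>_. 0)"
  shows "(t ^^ n) (peval n u (inv_op t)) = peval n (\<lambda>j. u (n - j)) t"
proof -
  let ?r = "inv_op t"
  have r: "?r \<in> K" using inv_op_closed t by blast
  have cancel: "(t ^^ n) ((?r ^^ j) x) = (t ^^ (n - j)) x" if "j \<le> n" for j x
  proof -
    have tr: "(t ^^ j) ((?r ^^ j) x) = x" for j
    proof (induction j)
      case (Suc j)
      have "(t ^^ Suc j) ((?r ^^ Suc j) x) = t ((t ^^ j) (?r ((?r ^^ j) x)))" by simp
      also have "\<dots> = t (?r ((t ^^ j) ((?r ^^ j) x)))"
        using commute[OF pow_closed[OF t(1)] r] by simp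
      finally show ?case using Suc inv_op_right[OF t] by simp
    qed simp
    have "t ^^ n = (t ^^ (n - j)) \<circ> (t ^^ j)" using that by (simp flip: funpow_add)
    then show ?thesis by (simp add: tr)
  qed
  have "(t ^^ n) (peval n u ?r) = (\<Sum>j\<le>n. (t ^^ (n - j)) (u j))"
    unfolding peval_sum[OF r] op_sum[OF pow_closed[OF t(1)]] by (intro sum.cong) (auto simp: cancel)
  also have "\<dots> = (\<Sum>j\<le>n. (t ^^ j) (u (n - j)))"
    by (rule sum.reindex_bij_witness[of _ "\<lambda>j. n - j" "\<lambda>j. n - j"]) auto
  finally show ?thesis by (simp add: peval_sum[OF t(1)])
qed

lemma poly_fun_square_pow:
  "poly_fun n g \<Longrightarrow> poly_fun (n + 2 * j) (\<lambda>t. ((t \<circ> t) ^^ j) (g t))"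
proof (induction j)
  case (Suc j)
  then have "poly_fun (Suc (Suc (n + 2 * j))) (\<lambda>t. t (t (((t \<circ> t) ^^ j) (g t))))"
    by (intro poly_fun_mult) (simp only:)
  then show ?case by (simp add: o_def)
qed simp

end

section \<open>The Hua maps depend quadratically on the parameter\<close>

text \<open>
  \<open>T\<close> stands for \<open>\<tau>\<close>; only its values on \<open>U - {0}\<close> are meaningful. In a Jordan algebra \<open>T x = - x\<^sup>-\<^sup>1\<close>, and \<open>h_T_sum\<close> reads
  \<open>a (a + y)\<^sup>-\<^sup>1 a - y (a + y)\<^sup>-\<^sup>1 y = a - y\<close>.
\<close>

locale hua_system = operator_field K for K :: "('a::ab_group_add \<Rightarrow> 'a) set" +
  fixes h :: "'a \<Rightarrow> 'a \<Rightarrow> 'a" and T :: "'a \<Rightarrow> 'a" and e :: 'a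
  assumes h_additive: "Modules.additive (h a)"
    and h_of_zero: "h 0 x = 0"
    and h_bij: "a \<noteq> 0 \<Longrightarrow> bij (h a)"
    and h_op: "k \<in> K \<Longrightarrow> h a (k x) = k (h a x)"
    and h_uminus: "h (- a) = h a"
    and h_unit: "h e x = x"
    and h_fundamental: "h (h b a) x = h b (h a (h b x))"
    and unit_nonzero: "e \<noteq> 0"
    and T_nonzero: "x \<noteq> 0 \<Longrightarrow> T x \<noteq> 0"
    and T_T: "x \<noteq> 0 \<Longrightarrow> T (T x) = x"
    and h_T: "a \<noteq> 0 \<Longrightarrow> h a (T a) = - a"
    and h_T_sum: "\<lbrakk>a \<noteq> 0; y \<noteq> 0; a + y \<noteq> 0\<rbrakk> \<Longrightarrow> h a (T (a + y)) - h y (T (a + y)) = y - a"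
    and finite_dim: "finite_dim_over K"
    and infinite_centroid: "infinite (K \<inter> {k. \<forall>a x. h (k a) x = h a (k (k x))})"
begin

definition C :: "('a \<Rightarrow> 'a) set"
  where "C = {k \<in> K. k \<noteq> (\<lambda>_. 0) \<and> (\<forall>a x. h (k a) x = k (k (h a x)))}"

lemma C_infinite: "infinite C"
proof -
  have "K \<inter> {k. \<forall>a x. h (k a) x = h a (k (k x))} \<subseteq> insert (\<lambda>_. 0) C"
    by (auto simp: C_def h_op)
  then show ?thesis using infinite_centroid finite_subset by auto
qed

lemma C_K: "k \<in> C \<Longrightarrow> k \<in> K" and C_nonzero: "k \<in> C \<Longrightarrow> k \<noteq> (\<lambda>_. 0)"
  and h_C: "k \<in> C \<Longrightarrow> h (k a) x = k (k (h a x))"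
  by (auto simp: C_def)

lemma C_eq_zero_iff: "k \<in> C \<Longrightarrow> k x = 0 \<longleftrightarrow> x = 0"
  using op_eq_zero_iff C_K C_nonzero by blast

lemma C_inv: assumes "k \<in> C" shows "inv_op k \<in> C"
proof -
  note k = C_K[OF assms] C_nonzero[OF assms]
  have "h (inv_op k a) x = inv_op k (inv_op k (h a x))" for a x
  proof -
    have "h a x = k (k (h (inv_op k a) x))" using h_C[OF assms, of "inv_op k a"] inv_op_right[OF k] by simp
    then show ?thesis using inv_op_left[OF k] by simp
  qed
  moreover have "inv_op k \<noteq> (\<lambda>_. 0)"
    using inv_op_left[OF k, of e] unit_nonzero by metis
  ultimately show ?thesis using inv_op_closed[OF k] by (simp add: C_def)
qed

lemma C_comp: assumes "k \<in> C" "l \<in> C" shows "k \<circ> l \<in> C"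
proof -
  have "k \<circ> l \<noteq> (\<lambda>_. 0)"
    using C_eq_zero_iff[OF assms(1)] C_eq_zero_iff[OF assms(2)] unit_nonzero by (metis comp_apply)
  then show ?thesis
    using assms comp_closed[of k l] by (auto simp: C_def commute[of k l])
qed

lemmas h_add = additive.add[OF h_additive]
  and h_zero = additive.zero[OF h_additive]
  and h_minus = additive.minus[OF h_additive]
  and h_diff = additive.diff[OF h_additive]

lemma h_inj: "a \<noteq> 0 \<Longrightarrow> h a x = h a y \<longleftrightarrow> x = y"
  using h_bij bij_is_inj inj_eq by metis

definition hi :: "'a \<Rightarrow> 'a \<Rightarrow> 'a" where "hi a = inv_into UNIV (h a)"

lemma h_hi: "a \<noteq> 0 \<Longrightarrow> h a (hi a x) = x" and hi_h: "a \<noteq> 0 \<Longrightarrow> hi a (h a x) = x"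
  unfolding hi_def using h_bij[of a] by (simp_all add: bij_is_surj surj_f_inv_f bij_is_inj)

lemma hi_eqI: "a \<noteq> 0 \<Longrightarrow> h a x = y \<Longrightarrow> hi a y = x"
  using hi_h by blast

lemma hi_additive: "a \<noteq> 0 \<Longrightarrow> Modules.additive (hi a)"
  by (intro additive.intro hi_eqI) (auto simp: h_add h_hi)

lemma hi_op: "a \<noteq> 0 \<Longrightarrow> k \<in> K \<Longrightarrow> hi a (k x) = k (hi a x)"
  by (rule hi_eqI) (auto simp: h_op h_hi)

text \<open>In Jordan terms this is (k a)^{-1} = k^{-1} a^{-1}. It holds because \<open>h a\<close>
  is injective and \<open>h_T\<close> determines \<open>T a\<close>.\<close>

lemma T_C: assumes "k \<in> C" "a \<noteq> 0" shows "k (T (k a)) = T a"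
proof -
  have "k (h a (k (T (k a)))) = k (h a (T a))"
    using h_T[of "k a"] h_T[of a] h_C[OF assms(1), of a "T (k a)"] C_eq_zero_iff[OF assms(1)] assms C_K
    by (simp add: h_op op_simps)
  then have "k (h a (k (T (k a))) - h a (T a)) = 0" using C_K[OF assms(1)] by (simp add: op_simps)
  then show ?thesis using C_eq_zero_iff[OF assms(1)] h_inj[OF assms(2)] by simp
qed

lemma T_uminus: "a \<noteq> 0 \<Longrightarrow> T (- a) = - T a"
  using h_T[of a] h_T[of "- a"] h_inj[of a "T (- a)" "- T a"] by (simp add: h_uminus h_minus)

section \<open>Values of T and h along a line\<close>

lemma h_T_diff: "a + y \<noteq> 0 \<Longrightarrow> h a (T (a + y)) - h y (T (a + y)) = y - a"
  using h_T_sum[of a y] h_T[of a] h_T[of y] by (cases "a = 0"; cases "y = 0") (auto simp: h_of_zero)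

text \<open>The scalar factor 1 + r^2 A clears the denominator of T (c + r y), obtained from (1 -
  r^2 D) v = T c + r h_c^{-1} y. The terms of order 0 and 1 in r are displayed because both are
  extracted later: the first for polynomiality of \<open>h\<close> on lines, the second for the
  linearised identity.\<close>

lemma T_expansion:
  assumes c: "c \<noteq> 0"
  shows "\<exists>N A q. (\<forall>r\<in>K. A r \<in> K) \<and> (\<forall>x. poly_fun N (\<lambda>r. A r x)) \<and> poly_fun N q \<and>
    (\<forall>r\<in>insert (\<lambda>_. 0) C. c + r y \<noteq> 0 \<longrightarrow>
      T (c + r y) + r (r (A r (T (c + r y)))) = T c + r (hi c y) + r (r (q r)))"
proof -
  define D where "D x = hi c (h y x)" for x
  have D: "Modules.additive D" "k \<in> K \<Longrightarrow> D (k x) = k (D x)" for k x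
    unfolding D_def using hi_additive[OF c] hi_op[OF c]
    by (auto simp: Modules.additive_def h_add h_op)
  obtain m k where k: "\<And>j. k j \<in> K" "k m = id" "\<And>x. (\<Sum>j\<le>m. k j ((D ^^ j) x)) = 0"
    using monic_annihilator[OF finite_dim D] by blast
  have "m \<noteq> 0"
  proof
    assume "m = 0"
    with k(2) k(3)[of e] show False using unit_nonzero by simp
  qed
  then obtain m' where m: "m = Suc m'" by (cases m) auto
  have Dj: "Modules.additive (D ^^ j)" "k \<in> K \<Longrightarrow> (D ^^ j) (k x) = k ((D ^^ j) x)" for j k x
    using D by (induction j) (auto simp: Modules.additive_def)
  define w where "w r = T c + r (hi c y)" for r :: "'a \<Rightarrow> 'a"
  \<comment> \<open>\<open>W j r\<close> is the truncated Neumann series, the sum of (r^2 D)^i (w r)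
    over i < j. Unrolling the equation for v gives (r^2 D)^j v = v - W j r.\<close>
  define W where "W j r = ((\<lambda>z. w r + r (r (D z))) ^^ j) 0" for j r
  have W_Suc: "W (Suc j) r = w r + r (r (D (W j r)))" for j r
    by (simp add: W_def)
  have w_poly: "poly_fun 1 w"
    unfolding w_def using poly_fun_add[OF poly_fun_const poly_fun_mult[OF poly_fun_const[of 0]]] by simp
  have W_poly: "poly_fun (2 * j + 1) (W j)" for j
  proof (induction j)
    case 0
    show ?case unfolding W_def using poly_fun_const[of _ 0] by simp
  next
    case (Suc j)
    have "poly_fun (Suc (Suc (2 * j + 1))) (\<lambda>r. w r + r (r (D (W j r))))"
      using poly_fun_map[OF Suc D(1)] D(2)
      by (intro poly_fun_add poly_fun_mult poly_fun_mono[OF w_poly]) auto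
    then show ?case using W_Suc by simp
  qed
  \<comment> \<open>The factor is the sum of k_j r^{2(m-j)} over j \<le> m. Its term for j = m is 1
    and the others contain r^2; \<open>A\<close> is the rest after splitting off 1 and dividing by
    r^2. \<open>q\<close> arises in the same way on the right-hand side.\<close>
  define A where "A r x = (\<Sum>j\<le>m'. k j (((r \<circ> r) ^^ (m' - j)) x))" for r x
  define q where "q r = D (W m' r) + (\<Sum>j\<le>m'. k j (((r \<circ> r) ^^ (m' - j)) (W j r)))" for r
  define N where "N = 2 * m + 1"
  have "A r \<in> K" if "r \<in> K" for r
  proof -
    have "(\<lambda>x. \<Sum>j\<le>m'. (k j \<circ> ((r \<circ> r) ^^ (m' - j))) x) \<in> K"
      using k(1) that by (intro sum_closed comp_closed pow_closed) auto
    then show ?thesis by (simp add: A_def[abs_def])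
  qed
  moreover have "poly_fun N (\<lambda>r. A r x)" for x
    unfolding A_def
  proof (intro poly_fun_sum poly_fun_op[OF _ k(1)])
    fix j
    show "poly_fun N (\<lambda>r. ((r \<circ> r) ^^ (m' - j)) x)"
      by (rule poly_fun_mono[OF poly_fun_square_pow[OF poly_fun_const[of 0]]]) (simp add: N_def m)
  qed
  moreover have "poly_fun N q"
    unfolding q_def
  proof (intro poly_fun_add poly_fun_sum poly_fun_op[OF _ k(1)])
    have "poly_fun (2 * m' + 1) (\<lambda>r. D (W m' r))"
      by (rule poly_fun_map[OF W_poly D])
    then show "poly_fun N (\<lambda>r. D (W m' r))" by (rule poly_fun_mono) (simp add: N_def m)
    fix j assume "j \<in> {..m'}"
    then show "poly_fun N (\<lambda>r. ((r \<circ> r) ^^ (m' - j)) (W j r))"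
      by (intro poly_fun_mono[OF poly_fun_square_pow[OF W_poly]]) (simp add: N_def m)
  qed
  moreover have "T (c + r y) + r (r (A r (T (c + r y)))) = T c + r (hi c y) + r (r (q r))"
    if r: "r \<in> insert (\<lambda>_. 0) C" and nz: "c + r y \<noteq> 0" for r
  proof -
    have rK: "r \<in> K" using r C_K zero_closed by auto
    then have rr: "r \<circ> r \<in> K" by (simp add: comp_closed)
    define v where "v = T (c + r y)"
    have "h (r y) v = r (r (h y v))" using r h_C h_of_zero by auto
    then have "h c v - r (r (h y v)) = r y - c" using h_T_diff[OF nz] by (simp add: v_def)
    then have "hi c (h c v - r (r (h y v))) = hi c (r y - c)" by simp
    moreover have "hi c (- c) = T c" using c h_T by (intro hi_eqI)
    ultimately have v: "v - r (r (D v)) = w r"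
      using additive.diff[OF hi_additive[OF c]] additive.minus[OF hi_additive[OF c]] rK c
      by (simp add: hi_h hi_op D_def w_def)
    have vW: "((r \<circ> r) ^^ j) ((D ^^ j) v) = v - W j r" for j
    proof (induction j)
      case 0
      then show ?case by (simp add: W_def)
    next
      case (Suc j)
      have "((r \<circ> r) ^^ Suc j) ((D ^^ Suc j) v) = r (r (D (((r \<circ> r) ^^ j) ((D ^^ j) v))))"
        using D(2)[OF pow_closed[OF rr]] by simp
      also have "\<dots> = r (r (D v)) - r (r (D (W j r)))"
        unfolding Suc using rK by (simp add: additive.diff[OF D(1)] op_simps)
      also have "\<dots> = v - W (Suc j) r" using v by (simp add: W_Suc algebra_simps)
      finally show ?case .
    qed
    have "0 = ((r \<circ> r) ^^ m) (\<Sum>j\<le>m. k j ((D ^^ j) v))"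
      using k(3) op_zero[OF pow_closed[OF rr]] by simp
    also have "\<dots> = (\<Sum>j\<le>m. k j (((r \<circ> r) ^^ (m - j)) (v - W j r)))"
      unfolding op_sum[OF pow_closed[OF rr]]
    proof (intro sum.cong refl)
      fix j assume "j \<in> {..m}"
      then have "(r \<circ> r) ^^ m = ((r \<circ> r) ^^ (m - j)) \<circ> ((r \<circ> r) ^^ j)" by (simp flip: funpow_add)
      then have "((r \<circ> r) ^^ m) ((D ^^ j) v) = ((r \<circ> r) ^^ (m - j)) (v - W j r)"
        by (simp only: comp_apply[of "(r \<circ> r) ^^ (m - j)"] vW)
      then show "((r \<circ> r) ^^ m) (k j ((D ^^ j) v)) = k j (((r \<circ> r) ^^ (m - j)) (v - W j r))"
        using commute[OF pow_closed[OF rr] k(1)] by simp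
    qed
    also have "\<dots> = (\<Sum>j\<le>m'. k j (((r \<circ> r) ^^ (m - j)) (v - W j r))) + (v - W m r)"
      by (simp add: m k(2)[unfolded m])
    also have "(\<Sum>j\<le>m'. k j (((r \<circ> r) ^^ (m - j)) (v - W j r))) =
        (\<Sum>j\<le>m'. r (r (k j (((r \<circ> r) ^^ (m' - j)) (v - W j r)))))"
      using commute[OF rK k(1)] by (intro sum.cong refl) (simp add: m Suc_diff_le)
    also have "\<dots> = r (r (\<Sum>j\<le>m'. k j (((r \<circ> r) ^^ (m' - j)) (v - W j r))))"
      using rK by (simp add: op_sum)
    also have "(\<Sum>j\<le>m'. k j (((r \<circ> r) ^^ (m' - j)) (v - W j r))) = A r v - (\<Sum>j\<le>m'. k j (((r \<circ> r) ^^ (m' - j)) (W j r)))"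
      by (simp add: A_def op_diff[OF pow_closed[OF rr]] op_diff[OF k(1)] sum_subtractf)
    finally have "v + r (r (A r v)) = w r + r (r (q r))"
      using rK by (simp add: q_def m W_Suc op_simps algebra_simps)
    then show ?thesis by (simp add: v_def w_def)
  qed
  ultimately show ?thesis by (intro exI[of _ N] exI[of _ A] exI[of _ q]) auto
qed

text \<open>The hypothesis \<open>generic\<close> keeps T (c + r y) meaningful for all scalars in
  question. At s = 0 the identity \<open>key\<close> would read off h (a + t y) (T c), but s is
  invertible there, and the occurrences of \<open>inv_op s\<close> make its right-hand side not
  visibly polynomial in \<open>s\<close>. By \<open>key\<close> it is one on \<open>C\<close>, so
  interpolation over s in \<open>C\<close> reaches the coefficient at 0.\<close>

lemma h_line_polynomial_generic:
  assumes c: "c \<noteq> 0" and generic: "\<And>r. r \<in> insert (\<lambda>_. 0) C \<Longrightarrow> c + r y \<noteq> 0"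
  shows "\<exists>n g. poly_fun n g \<and> (\<forall>t\<in>insert (\<lambda>_. 0) C. h (a + t y) (T c) = g t)"
proof -
  obtain N A q where A: "\<And>r. r \<in> K \<Longrightarrow> A r \<in> K" "\<And>x. poly_fun N (\<lambda>r. A r x)" and q: "poly_fun N q"
    and expand: "\<And>r. r \<in> insert (\<lambda>_. 0) C \<Longrightarrow>
      T (c + r y) + r (r (A r (T (c + r y)))) = T c + r (hi c y) + r (r (q r))"
    using T_expansion[OF c, of y] generic by metis
  define Q where "Q r = T c + r (hi c y) + r (r (q r))" for r
  define p where "p r x = x + r (r (A r x))" for r x
  define M where "M = Suc (Suc N)"
  have Q: "poly_fun M Q"
    unfolding Q_def M_def
    by (intro poly_fun_add poly_fun_const poly_fun_mult poly_fun_mono[OF poly_fun_mult[OF poly_fun_const[of 0]]] q) simp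
  have p: "poly_fun M (\<lambda>r. p r x)" for x
    unfolding p_def M_def by (intro poly_fun_add poly_fun_const poly_fun_mult A)
  have pK: "p r \<in> K" if "r \<in> K" for r
  proof -
    have "(\<lambda>x. id x + (r \<circ> (r \<circ> A r)) x) \<in> K"
      using that A(1) by (intro add_closed comp_closed id_closed)
    then show ?thesis by (simp add: p_def[abs_def])
  qed
  obtain w where w: "\<And>r. r \<in> K \<Longrightarrow> Q r = peval M w r" using Q by (auto simp: poly_fun_def)
  have w0: "w 0 = T c" using w[OF zero_closed] by (simp add: Q_def peval_at_zero)
  \<comment> \<open>For z = c + t s y, the point s^{-1} z is split as (a + t y) + (s^{-1} c - a),
    whose second summand is free of \<open>t\<close>. Applying s^{-1} and the scalar
    \<open>p\<close> to \<open>h_T_diff\<close> turns T (s^{-1} z) into the polynomial value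
    \<open>Q\<close>, by \<open>T_C\<close>; \<open>R\<close> collects everything except the term in
    h (a + t y).\<close>
  define R where "R s t = h (inv_op s c - a) (Q (t \<circ> s)) + p (t \<circ> s) (inv_op s (inv_op s c - a - a))
      - t (p (t \<circ> s) (inv_op s y))" for s t
  text \<open>The left-hand side is polynomial in \<open>s\<close> for fixed \<open>t\<close>, the right-hand side is polynomial
    in \<open>t\<close> for fixed \<open>s\<close>; the constant coefficient in \<open>s\<close> is \<open>h (a + t y) (T c)\<close>.\<close>
  have key: "h (a + t y) (Q (t \<circ> s)) = R s t" if t: "t \<in> insert (\<lambda>_. 0) C" and s: "s \<in> C" for s t
  proof -
    define r where "r = t \<circ> s"
    define s' where "s' = inv_op s"
    have tK: "t \<in> K" using t C_K zero_closed by auto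
    have rI: "r \<in> insert (\<lambda>_. 0) C" using t s C_comp by (auto simp: r_def o_def)
    then have rK: "r \<in> K" using C_K zero_closed by auto
    have s': "s' \<in> C" "\<And>x. s' (s x) = x"
      using C_inv[OF s] inv_op_left[OF C_K[OF s] C_nonzero[OF s]] by (auto simp: s'_def)
    note s'K = C_K[OF s'(1)]
    define z where "z = c + r y"
    have z: "z \<noteq> 0" using generic[OF rI] by (simp add: z_def)
    have s'z: "s' z = s' c + t y"
      using s'(2) by (simp add: z_def r_def op_add[OF s'K] commute[OF tK C_K[OF s]])
    have "a + t y + (s' c - a) = s' z" by (simp add: s'z)
    then have "h (a + t y) (T (s' z)) - h (s' c - a) (T (s' z)) = s' c - a - (a + t y)"
      using h_T_diff[of "a + t y" "s' c - a"] C_eq_zero_iff[OF s'(1)] z by simp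
    then have "p r (s' (h (a + t y) (T (s' z)) - h (s' c - a) (T (s' z)))) =
        p r (s' (s' c - a - (a + t y)))"
      by simp
    then have "h (a + t y) (p r (s' (T (s' z)))) - h (s' c - a) (p r (s' (T (s' z)))) =
        p r (s' (s' c - a - a)) - t (p r (s' y))"
      using pK[OF rK] s'K tK
      by (simp add: op_diff op_add h_op commute[OF s'K tK] commute[OF pK[OF rK] tK] algebra_simps)
    moreover have "p r (s' (T (s' z))) = Q r"
    proof -
      have "p r (s' (T (s' z))) = p r (T z)" by (rule arg_cong[OF T_C[OF s'(1) z]])
      also have "\<dots> = Q r" using expand[OF rI] by (simp only: p_def Q_def z_def)
      finally show ?thesis .
    qed
    ultimately have "h (a + t y) (Q r) - h (s' c - a) (Q r) = p r (s' (s' c - a - a)) - t (p r (s' y))"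
      by (simp only:)
    then show ?thesis unfolding R_def r_def s'_def by (simp only: algebra_simps)
  qed
  \<comment> \<open>For fixed \<open>s\<close> the operator \<open>h (inv_op s c - a)\<close> is one
    fixed linear map, and the degree bound in \<open>t\<close> is the same for all
    \<open>s\<close>.\<close>
  have "poly_fun (Suc M) (R s)" if s: "s \<in> C" for s
    unfolding R_def
  proof (intro poly_fun_diff poly_fun_add poly_fun_mult)
    note sK = C_K[OF s]
    have "poly_fun M (\<lambda>t. h (inv_op s c - a) (Q (t \<circ> s)))"
      by (rule poly_fun_map[OF poly_fun_dilate[OF Q sK] h_additive h_op])
    then show "poly_fun (Suc M) (\<lambda>t. h (inv_op s c - a) (Q (t \<circ> s)))" by (rule poly_fun_mono) simp
    show "poly_fun M (\<lambda>t. p (t \<circ> s) (inv_op s y))"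
      by (rule poly_fun_dilate[OF p sK])
    show "poly_fun (Suc M) (\<lambda>t. p (t \<circ> s) (inv_op s (inv_op s c - a - a)))"
      by (rule poly_fun_mono[OF poly_fun_dilate[OF p sK]]) simp
  qed
  then have "\<forall>s. \<exists>u. s \<in> C \<longrightarrow> (\<forall>t\<in>K. R s t = peval (Suc M) u t)"
    unfolding poly_fun_def by blast
  then obtain z where z: "\<And>s t. s \<in> C \<Longrightarrow> t \<in> K \<Longrightarrow> R s t = peval (Suc M) (z s) t"
    by metis
  obtain L where L: "extracts C M L"
    using extracts_exists[OF C_infinite] C_K by blast
  have "h (a + t y) (T c) = peval (Suc M) (\<lambda>j. L (\<lambda>s. z s j)) t" if t: "t \<in> insert (\<lambda>_. 0) C" for t
  proof -
    have tK: "t \<in> K" using t C_K zero_closed by auto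
    have "L (\<lambda>s. R s t) = L (peval M (\<lambda>j. h (a + t y) ((t ^^ j) (w j))))"
    proof (rule extracts_cong[OF L])
      fix s assume s: "s \<in> C"
      note sK = C_K[OF s]
      have "t \<circ> s = s \<circ> t" using commute[OF tK sK] by auto
      then have "Q (t \<circ> s) = peval M w (s \<circ> t)" using w comp_closed[OF sK tK] by simp
      also have "\<dots> = peval M (\<lambda>j. (t ^^ j) (w j)) s" by (rule peval_dilate[OF sK tK])
      finally have "h (a + t y) (Q (t \<circ> s)) = h (a + t y) (peval M (\<lambda>j. (t ^^ j) (w j)) s)"
        by (rule arg_cong)
      also have "\<dots> = peval M (\<lambda>j. h (a + t y) ((t ^^ j) (w j))) s"
        by (rule peval_map) (simp_all add: sK h_additive h_op)
      finally show "R s t = peval M (\<lambda>j. h (a + t y) ((t ^^ j) (w j))) s"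
        unfolding key[OF t s] .
    qed
    also have "\<dots> = h (a + t y) (T c)" by (simp add: extracts_const[OF L] w0)
    finally have "h (a + t y) (T c) = L (\<lambda>s. R s t)" by simp
    also have "\<dots> = L (\<lambda>s. peval (Suc M) (z s) t)"
      using z[OF _ tK] by (rule extracts_cong[OF L])
    also have "\<dots> = peval (Suc M) (\<lambda>j. L (\<lambda>s. z s j)) t"
      by (rule extracts_peval[OF L tK])
    finally show ?thesis .
  qed
  then show ?thesis
    by (intro exI[of _ "Suc M"] exI[of _ "peval (Suc M) (\<lambda>j. L (\<lambda>s. z s j))"]) (auto simp: poly_fun_def)
qed

text \<open>A nonzero x equals T c for c = T x, which is the generic case unless c + r y = 0 for
  some r. In that case x is a scalar multiple of T y, and the splitting t y = (a + t y) + (- a) in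
  \<open>h_T_diff\<close> gives an explicit quadratic polynomial.\<close>

lemma h_line_polynomial:
  "\<exists>n g. poly_fun n g \<and> (\<forall>t\<in>insert (\<lambda>_. 0) C. h (a + t y) x = g t)"
proof (cases "x = 0 \<or> y = 0")
  case True
  have t0: "t 0 = 0" if "t \<in> insert (\<lambda>_. 0) C" for t
    using that C_K op_zero by auto
  have "\<forall>t\<in>insert (\<lambda>_. 0) C. h (a + t y) x = h a x"
  proof
    fix t assume "t \<in> insert (\<lambda>_. 0) C"
    then show "h (a + t y) x = h a x" using True t0[of t] by (elim disjE) (simp_all add: h_zero)
  qed
  then show ?thesis using poly_fun_const by blast
next
  case False
  define c where "c = T x"
  have c: "c \<noteq> 0" "T c = x" using False T_nonzero T_T by (auto simp: c_def)
  show ?thesis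
  proof (cases "\<forall>r\<in>insert (\<lambda>_. 0) C. c + r y \<noteq> 0")
    case True
    then have "c + r y \<noteq> 0" if "r \<in> insert (\<lambda>_. 0) C" for r using that by (rule bspec)
    from h_line_polynomial_generic[where a = a, OF c(1) this] show ?thesis unfolding c(2) .
  next
    case False
    then obtain r where r: "r \<in> C" "c + r y = 0" using c(1) by auto
    have y: "y \<noteq> 0" using \<open>\<not> (x = 0 \<or> y = 0)\<close> by simp
    note rK = C_K[OF r(1)]
    have r': "inv_op r \<in> K" using C_inv[OF r(1)] C_K by blast
    have "c = - r y" using r(2) by (simp add: eq_neg_iff_add_eq_0)
    then have "x = - T (r y)" using T_uminus[of "r y"] C_eq_zero_iff[OF r(1)] y c(2) by simp
    moreover have "T (r y) = inv_op r (T y)"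
      using T_C[OF r(1) y] inv_op_left[OF rK C_nonzero[OF r(1)]] by metis
    ultimately have x: "x = - inv_op r (T y)" by simp
    have line: "h (a + t y) (T y) = h a (T y) - t (a + a) - t (t y)" if t: "t \<in> insert (\<lambda>_. 0) C" for t
    proof (cases "t \<in> C")
      case True
      note tK = C_K[OF True]
      have "h (a + t y) (T (t y)) - h (- a) (T (t y)) = - a - (a + t y)"
        using h_T_diff[of "a + t y" "- a"] C_eq_zero_iff[OF True] y by simp
      then have "t (h (a + t y) (T (t y)) - h a (T (t y))) = t (- a - (a + t y))"
        by (simp add: h_uminus)
      then have "h (a + t y) (t (T (t y))) - h a (t (T (t y))) = - t (a + a) - t (t y)"
        using tK by (simp add: op_simps h_op)
      then show ?thesis by (simp add: T_C[OF True y] algebra_simps)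
    qed (use t in simp)
    have "poly_fun 2 (\<lambda>t. - inv_op r (h a (T y) - t (a + a) - t (t y)))"
      unfolding numeral_2_eq_2
      by (intro poly_fun_minus poly_fun_op[OF _ r'] poly_fun_diff poly_fun_const poly_fun_mult)
    moreover have "h (a + t y) x = - inv_op r (h a (T y) - t (a + a) - t (t y))"
      if "t \<in> insert (\<lambda>_. 0) C" for t
      unfolding x using line[OF that] r' by (simp add: h_minus h_op)
    ultimately show ?thesis by blast
  qed
qed

section \<open>The polarisation of h\<close>

definition B :: "'a \<Rightarrow> 'a \<Rightarrow> 'a \<Rightarrow> 'a"
  where "B a b x = h (a + b) x - h a x - h b x"

lemma h_sum: "h (a + b) x = h a x + h b x + B a b x"
  by (simp add: B_def)

lemma B_commute: "B a b x = B b a x"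
  by (simp add: B_def add.commute)

lemma B_additive: "B a b (x + y) = B a b x + B a b y"
  by (simp add: B_def h_add algebra_simps)

lemma B_minus: "B a b (- x) = - B a b x"
  by (simp add: B_def h_minus algebra_simps)

lemma B_op: "k \<in> K \<Longrightarrow> B a b (k x) = k (B a b x)"
  by (simp add: B_def h_op op_simps)

lemma B_h: "B (h c a) (h c b) x = h c (B a b (h c x))"
  by (simp add: B_def h_fundamental h_diff flip: h_add)

text \<open>The polynomials for \<open>h (a + t y) x\<close> and \<open>h (t a + y) x\<close> are reversals of each
  other, up to a factor \<open>t\<^sup>2\<close>; this bounds the degree by 2.\<close>

lemma h_line_quadratic:
  assumes t: "t \<in> C"
  shows "h (a + t y) x = h a x + t (B a y x) + t (t (h y x))"
proof -
  obtain n g n' g' where g: "poly_fun n g" "\<forall>t\<in>insert (\<lambda>_. 0) C. h (a + t y) x = g t"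
    and g': "poly_fun n' g'" "\<forall>t\<in>insert (\<lambda>_. 0) C. h (y + t a) x = g' t"
    using h_line_polynomial[of a y x] h_line_polynomial[of y a x] by blast
  define m where "m = Suc (Suc (max n n'))"
  have "poly_fun m g" "poly_fun m g'"
    using g(1) g'(1) by (auto elim!: poly_fun_mono simp: m_def)
  then obtain u u' where "\<forall>t\<in>K. g t = peval m u t" "\<forall>t\<in>K. g' t = peval m u' t"
    unfolding poly_fun_def by blast
  then have u: "h (a + t y) x = peval m u t" and u': "h (y + t a) x = peval m u' t"
    if "t \<in> insert (\<lambda>_. 0) C" for t
    using that g(2) g'(2) C_K zero_closed by auto
  \<comment> \<open>For the polynomials p, p' with coefficients \<open>u\<close>, \<open>u'\<close>,
    both sides of p(s) = s^2 p'(s^{-1}) are multiplied by s^m to clear denominators;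
    \<open>\<alpha>\<close> and \<open>\<beta>\<close> list the resulting coefficients up to degree
    2m. As \<open>\<alpha>\<close> starts in degree m and \<open>\<beta>\<close> ends in degree m +
    2, only \<open>u 0\<close>, \<open>u 1\<close> and \<open>u 2\<close> can survive. The choice of
    \<open>m\<close> ensures m \<ge> 2.\<close>
  define \<alpha> where "\<alpha> j = (if j < m then 0 else u (j - m))" for j
  define \<beta> where "\<beta> j = (if j < 2 then 0 else if j - 2 \<le> m then u' (m - (j - 2)) else 0)" for j
  have eq: "peval (m + m) (\<lambda>j. \<alpha> j - \<beta> j) s = 0" if s: "s \<in> C" for s
  proof -
    note sK = C_K[OF s] and s0 = C_nonzero[OF s]
    have "a + s y = s (y + inv_op s a)"
      using inv_op_right[OF sK s0] sK by (simp add: op_simps add.commute)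
    then have "peval m u s = s (s (peval m u' (inv_op s)))"
      using u[of s] u'[of "inv_op s"] h_C[OF s] C_inv[OF s] s by simp
    then have "(s ^^ m) (peval m u s) = s (s ((s ^^ m) (peval m u' (inv_op s))))"
      using commute[OF pow_closed[OF sK] sK] by simp
    also have "\<dots> = (s ^^ 2) (peval m (\<lambda>j. u' (m - j)) s)"
      by (simp add: peval_reverse[OF sK s0] numeral_2_eq_2)
    also have "peval m (\<lambda>j. u' (m - j)) s = peval (m + m - 2) (\<lambda>j. if j \<le> m then u' (m - j) else 0) s"
      by (rule peval_extend[OF sK, symmetric]) (simp add: m_def)
    also have "(s ^^ 2) \<dots> = peval (m + m) \<beta> s"
    proof -
      have "m + m - 2 + 2 = m + m" by (simp add: m_def)
      then show ?thesis unfolding peval_shift_pow[OF sK] \<beta>_def[abs_def] by (simp only:)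
    qed
    finally have "peval (m + m) \<alpha> s = peval (m + m) \<beta> s"
      using peval_shift_pow[OF sK, of m m u] by (simp add: \<alpha>_def[abs_def])
    then show ?thesis
      using peval_add[OF sK, of "m + m" "\<lambda>j. \<alpha> j - \<beta> j" \<beta>] by simp
  qed
  have \<alpha>\<beta>: "\<alpha> j = \<beta> j" if "j \<le> m + m" for j
    using peval_vanishing[OF C_infinite _ eq that] C_K by auto
  have high: "u j = 0" if "2 < j" "j \<le> m" for j
  proof -
    have "\<not> m + j - 2 \<le> m" using that by simp
    then show ?thesis using \<alpha>\<beta>[of "m + j"] that by (simp add: \<alpha>_def \<beta>_def)
  qed
  have u2: "u 2 = h y x"
    using \<alpha>\<beta>[of "m + 2"] u'[of "\<lambda>_. 0"] by (simp add: \<alpha>_def \<beta>_def m_def peval_at_zero)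
  have u0: "u 0 = h a x" using u[of "\<lambda>_. 0"] by (simp add: peval_at_zero)
  have quad: "h (a + s y) x = h a x + s (u 1) + s (s (h y x))" if s: "s \<in> C" for s
  proof -
    note sK = C_K[OF s]
    have "peval m u s = (\<Sum>j\<le>m. (s ^^ j) (u j))" by (rule peval_sum[OF sK])
    also have "\<dots> = (\<Sum>j\<in>{0, 1, 2}. (s ^^ j) (u j))"
      using high op_zero[OF pow_closed[OF sK]] by (intro sum.mono_neutral_right) (auto simp: m_def)
    also have "\<dots> = h a x + s (u 1) + s (s (h y x))"
      by (simp add: u0 u2 numeral_2_eq_2 u2[unfolded numeral_2_eq_2] add.assoc)
    finally show ?thesis using u s by auto
  qed
  \<comment> \<open>The middle coefficient is identified by the value at t = 1.\<close>
  have "id \<noteq> (\<lambda>_. 0 :: 'a)" using unit_nonzero by (metis id_apply)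
  then have "id \<in> C" using id_closed by (simp add: C_def)
  then have "u 1 = B a y x" using quad[of id] by (simp add: B_def)
  then show ?thesis using quad[OF t] by simp
qed

lemma B_C: "t \<in> C \<Longrightarrow> B a (t b) x = t (B a b x)"
  by (simp add: h_line_quadratic B_def h_C)

text \<open>Homogeneity turns the cocycle identity for \<open>B\<close> into additivity.\<close>

lemma B_add_right: "B a (b + c) x = B a b x + B a c x"
proof -
  obtain t where t: "t \<in> C" "t \<noteq> id"
    using C_infinite by (metis finite.emptyI finite_insert finite_subset insertCI subsetI)
  have tK: "t \<in> K" using t C_K by blast
  have cocycle: "B a (b + c) x + B b c x = B (a + b) c x + B a b x" for a b c
    by (simp add: B_def add.assoc)
  have 1: "B a (b + t c) x + t (B b c x) = t (B a (b + c) x + B b c x - B a b x) + B a b x" for b c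
    using cocycle[of a b c] cocycle[of a b "t c"] t(1) by (simp add: B_C)
  have 2: "B a (t b) x = t (B a b x)" "B a (t c) x = t (B a c x)" using t(1) by (simp_all add: B_C)
  \<comment> \<open>In terms of the defect \<delta>(b, c) = B a (b + c) - B a b - B a c, this says
    \<delta>(b, t c) = t \<delta>(b, c).\<close>
  have "B a (b + t c) x = B a b x + t (B a (b + c) x) - t (B a b x)"
    using 1[of b c] tK by (simp add: op_simps algebra_simps)
  \<comment> \<open>Writing b + t c = t (c + s b) with s = t^{-1} gives \<delta>(b, t c) =
    \<delta>(b, c) instead. Since t - 1 is invertible in \<open>K\<close>, the defect is
    zero.\<close>
  moreover have "B a (b + t c) x = t (B a c x) + B a (b + c) x - B a c x"
  proof -
    define s where "s = inv_op t"
    have s: "s \<in> C" "\<And>x. t (s x) = x"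
      using C_inv[OF t(1)] inv_op_right[OF tK C_nonzero[OF t(1)]] by (auto simp: s_def)
    have "B a (c + s b) x + B c (s b) x = B (a + c) (s b) x + B a c x" by (rule cocycle)
    then have "t (B a (c + s b) x + B c (s b) x) = t (B (a + c) (s b) x + B a c x)" by simp
    then have "B a (t (c + s b)) x + B c (t (s b)) x = B (a + c) (t (s b)) x + t (B a c x)"
      by (simp only: B_C[OF t(1)] op_add[OF tK, of "B _ _ x"])
    then have "B a (t (c + s b)) x + B c b x = B (a + c) b x + t (B a c x)"
      by (simp only: s(2))
    moreover have "B (a + c) b x = B a (b + c) x + B c b x - B a c x"
      using cocycle[of a c b] by (simp add: algebra_simps)
    ultimately show ?thesis using s tK by (simp add: op_simps algebra_simps)
  qed
  ultimately have "t (B a (b + c) x - B a b x - B a c x) - (B a (b + c) x - B a b x - B a c x) = 0"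
    using tK by (simp add: op_simps algebra_simps)
  moreover have "(\<lambda>z. t z - z) \<in> K" using diff_closed[OF tK id_closed] by simp
  moreover have "(\<lambda>z. t z - z) \<noteq> (\<lambda>_. 0)" using diff_nonzero[OF t(2)] by simp
  ultimately have "B a (b + c) x - B a b x - B a c x = 0" using op_eq_zero_iff by blast
  then show ?thesis by (simp add: algebra_simps)
qed

lemma B_add_left: "B (a + b) c x = B a c x + B b c x"
  using B_add_right B_commute by metis

text \<open>Comes from the splitting v = (v + d) + (- d). In a Jordan algebra it is V_{v,w} = 2 for
  w = v^{-1}, with the sign of T v = - v^{-1}.\<close>

lemma B_T: "v \<noteq> 0 \<Longrightarrow> B v d (T v) = - (d + d)"
  using h_T_diff[of "v + d" "- d"] h_T[of v] by (simp add: B_def h_uminus algebra_simps)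

section \<open>Linearisation and the last Jordan identity\<close>

text \<open>Linearisation of \<open>B_T\<close> in \<open>v\<close>: the coefficient of \<open>r\<close> in its instance for \<open>v + r y\<close>.\<close>

lemma B_T_linearised:
  assumes v: "v \<noteq> 0"
  shows "B v d (hi v y) + B y d (T v) = 0"
proof (cases "y = 0")
  case True
  then show ?thesis
    using hi_additive[OF v] by (simp add: additive.zero B_def h_zero h_of_zero)
next
  case False
  obtain N A q where A: "\<And>r. r \<in> K \<Longrightarrow> A r \<in> K" "\<And>x. poly_fun N (\<lambda>r. A r x)" and q: "poly_fun N q"
    and expand: "\<And>r. r \<in> insert (\<lambda>_. 0) C \<Longrightarrow> v + r y \<noteq> 0 \<Longrightarrow>
      T (v + r y) + r (r (A r (T (v + r y)))) = T v + r (hi v y) + r (r (q r))"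
    using T_expansion[OF v, of y] by metis
  \<comment> \<open>Since y is nonzero, at most one scalar of \<open>C\<close> is lost.\<close>
  define S where "S = {r \<in> C. v + r y \<noteq> 0}"
  have "r = s" if "r \<in> C" "s \<in> C" "v + r y = 0" "v + s y = 0" for r s
  proof (rule ccontr)
    assume "r \<noteq> s"
    then have "(\<lambda>x. r x - s x) \<noteq> (\<lambda>_. 0)" by (rule diff_nonzero)
    moreover have "(\<lambda>x. r x - s x) \<in> K" using that C_K diff_closed by blast
    moreover have "r y - s y = 0" using that(3,4) by (metis add_left_cancel diff_self)
    ultimately show False using op_eq_zero_iff False by blast
  qed
  then have "\<exists>r. C - S \<subseteq> {r}" unfolding S_def by blast
  then have "finite (C - S)" using finite_subset by blast
  then have S: "infinite S" using C_infinite by (metis Diff_infinite_finite finite_Diff2)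
  have SK: "S \<subseteq> K" using C_K by (auto simp: S_def)
  \<comment> \<open>Coefficients of 1 and r, and the tail, in the instance of \<open>B_T\<close> for
    v + r y after multiplication by 1 + r^2 A. That factor has no term of order r, so
    \<open>c1\<close> is the desired linearisation.\<close>
  define c0 where "c0 = B v d (T v) + (d + d)"
  define c1 where "c1 = B v d (hi v y) + B y d (T v)"
  define c2 where "c2 r = B v d (q r) + B y d (hi v y) + r (B y d (q r)) + A r (d + d)" for r
  have B_map: "poly_fun n g \<Longrightarrow> poly_fun n (\<lambda>r. B a b (g r))" for n g a b
    by (rule poly_fun_map) (auto intro: additive.intro simp: B_additive B_op)
  have "poly_fun (Suc N) c2"
    unfolding c2_def
    by (intro poly_fun_add poly_fun_mult poly_fun_const poly_fun_mono[OF A(2)] poly_fun_mono[OF B_map[OF q]] B_map q) auto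
  then obtain u where u: "\<And>r. r \<in> K \<Longrightarrow> c2 r = peval (Suc N) u r" by (auto simp: poly_fun_def)
  have vanish: "c0 + r (c1 + r (c2 r)) = 0" if r: "r \<in> S" for r
  proof -
    have rK: "r \<in> K" and nz: "v + r y \<noteq> 0" and rC: "r \<in> C" using r SK by (auto simp: S_def)
    define V where "V = T (v + r y)"
    have "B v d V + r (B y d V) = - (d + d)"
      using B_T[OF nz, of d] B_C[OF rC, of d y V] B_add_left[of v "r y" d V]
      by (simp add: V_def B_commute[of _ d])
    then have "B v d V + r (B y d V) + (d + d) = 0" by simp
    moreover from this have "r (r (A r (B v d V + r (B y d V) + (d + d)))) = 0"
      using rK A(1)[OF rK] by (simp add: op_simps)
    ultimately have "B v d V + r (B y d V) + (d + d) + r (r (A r (B v d V + r (B y d V) + (d + d)))) = 0"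
      by simp
    then have "B v d (V + r (r (A r V))) + r (B y d (V + r (r (A r V)))) + (d + d) + r (r (A r (d + d))) = 0"
      using rK A(1)[OF rK] commute[OF rK A(1)[OF rK]]
      by (simp add: B_additive B_op op_add algebra_simps)
    moreover have "V + r (r (A r V)) = T v + r (hi v y) + r (r (q r))"
      using expand rC nz by (simp add: V_def)
    ultimately show ?thesis
      using rK by (simp add: c0_def c1_def c2_def B_additive B_op op_add algebra_simps)
  qed
  then have "peval (Suc (Suc (Suc N))) (\<lambda>j. if j = 0 then c0 else if j = 1 then c1 else u (j - 2)) r = 0"
    if "r \<in> S" for r
    using vanish[OF that] u[OF subsetD[OF SK that]] by simp
  from peval_vanishing[OF S SK this, of 1] show ?thesis by (simp add: c1_def)
qed

text \<open>Read through \<open>quad_V\<close>, this is Q_a V_{a,b} = V_{b,a} Q_a. It is the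
  linearised identity at v = a for the vectors h a x and h a b: \<open>B_h\<close> pulls h a out,
  and h a (T a) = - a.\<close>

lemma V_commute: "B a (h a x) b = h a (B b x a)"
proof (cases "a = 0")
  case True
  then show ?thesis by (simp add: h_of_zero B_def)
next
  case False
  have "B a (h a x) b = - B (h a b) (h a x) (T a)"
    using B_T_linearised[OF False, of "h a x" "h a b"] by (simp add: hi_h[OF False] eq_neg_iff_add_eq_0)
  also have "\<dots> = h a (B b x a)"
    by (simp add: B_h h_T[OF False] B_minus h_minus)
  finally show ?thesis .
qed

end

section \<open>The prime field and Jordan algebras\<close>

lemma int_scale_add: "int_scale (m + n) a = int_scale m a + int_scale n (a :: 'a::ab_group_add)"
  and int_scale_mult: "int_scale (m * n) a = int_scale m (int_scale n a)"
  and int_scale_right_add: "int_scale m (a + b) = int_scale m a + int_scale m b"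
  and int_scale_zero: "int_scale 0 a = 0"
  and int_scale_one: "int_scale 1 a = a"
proof -
  let ?G = "\<lparr>carrier = UNIV, monoid.mult = (+), one = 0 :: 'a\<rparr>"
  interpret group ?G
    by (rule groupI) (auto simp: add.assoc intro: exI[of _ "- x" for x])
  show "int_scale (m + n) a = int_scale m a + int_scale n a"
    using int_pow_mult[of a m n] by (simp add: int_scale_def)
  show "int_scale (m * n) a = int_scale m (int_scale n a)"
    using int_pow_pow[of a n m] by (simp add: int_scale_def mult.commute)
  show "int_scale m (a + b) = int_scale m a + int_scale m b"
    using int_pow_mult_distrib[of a b m] by (simp add: int_scale_def add.commute)
  show "int_scale 0 a = 0" "int_scale 1 a = a"
    using int_pow_1[of a] by (simp_all add: int_scale_def)
qed

lemma int_scale_minus: "int_scale (- n) a = - int_scale n (a :: 'a::ab_group_add)"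
  using int_scale_add[of "- n" n a] by (simp add: int_scale_zero eq_neg_iff_add_eq_0)

lemma int_scale_additive: "Modules.additive (int_scale n :: 'a::ab_group_add \<Rightarrow> 'a)"
  by (intro additive.intro int_scale_right_add)

lemma int_scale_commute: "int_scale m (int_scale n a) = int_scale n (int_scale m (a :: 'a::ab_group_add))"
  by (metis int_scale_mult mult.commute)

lemma additive_int_scale:
  fixes f :: "'a::ab_group_add \<Rightarrow> 'b::ab_group_add"
  assumes f: "Modules.additive f"
  shows "f (int_scale n x) = int_scale n (f x)"
proof -
  have nat: "f (int_scale (int m) x) = int_scale (int m) (f x)" for m
    by (induction m)
      (simp_all add: int_scale_zero int_scale_add int_scale_one additive.zero[OF f] additive.add[OF f] add.commute)
  show ?thesis
    by (cases n rule: int_cases2) (simp_all add: nat int_scale_minus additive.minus[OF f])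
qed

section \<open>Rational scalars\<close>

context
  assumes tfd: "torsion_free_uniquely_divisible TYPE('a::ab_group_add)"
begin

lemma int_scale_cancel:
  assumes "n > 0" "int_scale n x = int_scale n y" shows "x = (y :: 'a)"
proof -
  have "int_scale n (x - y) = 0" using assms(2) by (simp add: additive.diff[OF int_scale_additive])
  then have "x - y = 0" using tfd assms(1) unfolding torsion_free_uniquely_divisible_def by blast
  then show ?thesis by simp
qed

text \<open>\<open>rat_scale\<close> is defined through the reduced fraction; admitting any fraction
  m / n lets the laws be checked by clearing denominators.\<close>

lemma rat_scale_eq:
  assumes n: "n > 0" and q: "q = of_int m / of_int n"
  shows "int_scale n (rat_scale q a) = int_scale m (a :: 'a)"
proof -
  obtain m0 n0 where mn: "quotient_of q = (m0, n0)" by fastforce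
  have n0: "n0 > 0" using quotient_of_denom_pos[OF mn] .
  have "\<exists>!b. int_scale n0 b = int_scale m0 a"
    using tfd n0 by (auto simp: torsion_free_uniquely_divisible_def)
  then have "int_scale n0 (THE b. int_scale n0 b = int_scale m0 a) = int_scale m0 a" by (rule theI')
  then have b: "int_scale n0 (rat_scale q a) = int_scale m0 a" by (simp add: rat_scale_def mn)
  have "(of_int m0 :: rat) * of_int n = of_int m * of_int n0"
    using q quotient_of_div[OF mn] n n0 by (simp add: field_simps)
  then have eq: "n * m0 = n0 * m" by (metis mult.commute of_int_eq_iff of_int_mult)
  have "int_scale n0 (int_scale n (rat_scale q a)) = int_scale n (int_scale m0 a)"
    using b int_scale_commute by metis
  also have "\<dots> = int_scale n0 (int_scale m a)" by (simp only: eq flip: int_scale_mult)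
  finally show ?thesis using int_scale_cancel[OF n0] by blast
qed

lemma rat_cases:
  fixes q :: rat
  obtains m n where "n > 0" "q = of_int m / of_int n"
  using quotient_of_denom_pos quotient_of_div by (metis prod.exhaust)

lemma additive_rat_scale:
  fixes f :: "'a \<Rightarrow> 'a"
  assumes "Modules.additive f"
  shows "f (rat_scale q x) = rat_scale q (f x)"
proof -
  obtain m n where mn: "n > 0" "q = of_int m / of_int n" by (rule rat_cases)
  show ?thesis
    by (rule int_scale_cancel[OF mn(1)]) (simp add: rat_scale_eq[OF mn] flip: additive_int_scale[OF assms])
qed

lemma rat_scale_add: "rat_scale (q + r) x = rat_scale q x + rat_scale r (x :: 'a)"
proof -
  obtain m n where q: "n > 0" "q = of_int m / of_int n" by (rule rat_cases)
  obtain k l where r: "l > 0" "r = of_int k / of_int l" by (rule rat_cases)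
  have nl: "n * l > 0" using q r by simp
  have "q + r = of_int (l * m + n * k) / of_int (n * l)"
    using q r by (simp add: field_simps)
  then have "int_scale (n * l) (rat_scale (q + r) x) = int_scale (l * m + n * k) x"
    by (rule rat_scale_eq[OF nl])
  also have "\<dots> = int_scale l (int_scale m x) + int_scale n (int_scale k x)"
    by (simp only: int_scale_add int_scale_mult)
  also have "\<dots> = int_scale l (int_scale n (rat_scale q x)) + int_scale n (int_scale l (rat_scale r x))"
    by (simp add: rat_scale_eq[OF q] rat_scale_eq[OF r])
  also have "\<dots> = int_scale (n * l) (rat_scale q x + rat_scale r x)"
    by (simp add: int_scale_mult int_scale_right_add int_scale_commute[of l n])
  finally show ?thesis by (rule int_scale_cancel[OF nl])
qed

lemma rat_scale_mult: "rat_scale (q * r) x = rat_scale q (rat_scale r (x :: 'a))"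
proof -
  obtain m n where q: "n > 0" "q = of_int m / of_int n" by (rule rat_cases)
  obtain k l where r: "l > 0" "r = of_int k / of_int l" by (rule rat_cases)
  have nl: "l * n > 0" using q r by simp
  have "q * r = of_int (m * k) / of_int (l * n)" using q r by simp
  then have "int_scale (l * n) (rat_scale (q * r) x) = int_scale (m * k) x"
    by (rule rat_scale_eq[OF nl])
  also have "\<dots> = int_scale m (int_scale k x)" by (rule int_scale_mult)
  also have "\<dots> = int_scale l (int_scale m (rat_scale r x))"
    by (simp add: int_scale_commute[of l m] rat_scale_eq[OF r])
  also have "\<dots> = int_scale (l * n) (rat_scale q (rat_scale r x))"
    by (simp add: int_scale_mult rat_scale_eq[OF q])
  finally show ?thesis by (rule int_scale_cancel[OF nl])
qed

lemma rat_scale_right_add: "rat_scale q (x + y) = rat_scale q x + rat_scale q (y :: 'a)"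
proof -
  obtain m n where q: "n > 0" "q = of_int m / of_int n" by (rule rat_cases)
  show ?thesis
    by (rule int_scale_cancel[OF q(1)]) (simp add: int_scale_right_add rat_scale_eq[OF q])
qed

lemma rat_scale_one: "rat_scale 1 x = (x :: 'a)"
  using rat_scale_eq[of 1 1 1 x] by (simp add: int_scale_one)

end

section \<open>The module structures and the characteristic\<close>

lemma abelian_group_scaled_group: "abelian_group (scaled_group s)"
proof (rule abelian_groupI)
  fix x assume "x \<in> carrier (scaled_group s)"
  show "\<exists>y\<in>carrier (scaled_group s). y \<oplus>\<^bsub>scaled_group s\<^esub> x = \<zero>\<^bsub>scaled_group s\<^esub>"
    by (rule bexI[of _ "- x"]) (simp_all add: scaled_group_def)
qed (simp_all add: scaled_group_def algebra_simps)

lemma scaled_group_simps: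
  "carrier (scaled_group s) = UNIV" "x \<oplus>\<^bsub>scaled_group s\<^esub> y = x + y"
  "\<zero>\<^bsub>scaled_group s\<^esub> = 0" "r \<odot>\<^bsub>scaled_group s\<^esub> x = s r x"
  by (simp_all add: scaled_group_def)

lemma scaled_group_minus: "x \<ominus>\<^bsub>scaled_group s\<^esub> y = x - y"
proof -
  interpret abelian_group "scaled_group s" by (rule abelian_group_scaled_group)
  have "\<ominus>\<^bsub>scaled_group s\<^esub> y = - y"
    by (rule minus_equality) (simp_all add: scaled_group_simps)
  then show ?thesis by (simp add: a_minus_def scaled_group_simps)
qed

lemma field_rat_field: "field rat_field"
proof -
  have "cring rat_field"
    by (rule cringI, rule abelian_groupI, simp_all add: rat_field_def algebra_simps)
      (auto intro: exI[of _ "- x" for x] comm_monoidI)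
  moreover have "\<exists>b. a * b = 1" if "a \<noteq> 0" for a :: rat
    using right_inverse[OF that] by blast
  ultimately show ?thesis
    by (intro cring.cring_fieldI2) (auto simp: rat_field_def)
qed

lemma (in operator_field) int_scale_closed: "int_scale n \<in> K"
proof -
  have nat: "(\<lambda>x. int_scale (int m) x) \<in> K" for m
  proof (induction m)
    case (Suc m)
    then show ?case
      using add_closed[OF Suc id_closed] by (simp add: int_scale_add int_scale_one add.commute)
  qed (simp add: int_scale_zero zero_closed)
  show ?thesis
  proof (cases n rule: int_cases2)
    case (nonneg m)
    then show ?thesis using nat by simp
  next
    case (nonpos m)
    then show ?thesis using minus_closed[OF nat[of m]] by (simp add: int_scale_minus[abs_def])
  qed
qed

text \<open>Integers act through \<open>K\<close>, so each acts as zero or invertibly. If some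
  positive integer acts as zero, the least such is prime because \<open>K\<close> has no zero
  divisors.\<close>

lemma (in operator_field) characteristic_cases:
  assumes "\<exists>x::'a. x \<noteq> 0"
  shows "torsion_free_uniquely_divisible TYPE('a) \<or> (\<exists>p. prime p \<and> elementary_abelian p TYPE('a))"
proof (cases "\<exists>n::nat. n > 0 \<and> (\<forall>x::'a. int_scale (int n) x = 0)")
  case True
  define P where "P n \<longleftrightarrow> n > 0 \<and> (\<forall>x::'a. int_scale (int n) x = 0)" for n :: nat
  define n where "n = (LEAST n. P n)"
  have n: "P n" using True LeastI_ex[of P] unfolding n_def P_def by blast
  have least: "\<not> P m" if "m < n" for m using not_less_Least that unfolding n_def by blast
  have n1: "n \<noteq> 1" using n assms by (auto simp: P_def int_scale_one)
  have factor: "a = n \<or> b = n" if ab: "n = a * b" for a b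
  proof (rule ccontr)
    assume "\<not> (a = n \<or> b = n)"
    then have lt: "a < n" "b < n" "a > 0" "b > 0"
      using ab n by (auto simp: P_def intro!: le_neq_implies_less)
    then obtain y :: 'a where y: "int_scale (int b) y \<noteq> 0" using least unfolding P_def by blast
    have "int_scale (int a) (int_scale (int b) y) = 0"
      using n ab by (simp add: P_def int_scale_mult)
    then have "int_scale (int a) = (\<lambda>_. 0 :: 'a)"
      using op_eq_zero_iff[OF int_scale_closed] y by blast
    then show False using least[OF lt(1)] lt(3) by (auto simp: P_def)
  qed
  have "prime n"
    unfolding prime_nat_iff
  proof (intro conjI allI impI)
    show "1 < n" using n n1 by (simp add: P_def)
    fix a assume "a dvd n"
    then obtain b where "n = a * b" by (auto simp: dvd_def)
    with factor[OF this] n show "a = 1 \<or> a = n" by (auto simp: P_def)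
  qed
  then show ?thesis using n by (auto simp: P_def elementary_abelian_def intro!: disjI2 exI[of _ "int n"])
next
  case False
  have nz: "int_scale n \<noteq> (\<lambda>_. 0 :: 'a)" if "n > 0" for n
    using False that by (metis int_nat_eq less_imp_le zero_less_nat_eq)
  have "torsion_free_uniquely_divisible TYPE('a)"
    unfolding torsion_free_uniquely_divisible_def
  proof (intro conjI allI impI)
    fix n :: int and a :: 'a assume n: "n > 0"
    show "a = 0" if "int_scale n a = 0" using op_eq_zero_iff[OF int_scale_closed nz[OF n]] that by blast
    show "\<exists>!b. int_scale n b = a"
      using inv_op_left[OF int_scale_closed nz[OF n]] inv_op_right[OF int_scale_closed nz[OF n]] by metis
  qed
  then show ?thesis by blast
qed

text \<open>Doubling is itself a scalar of \<open>K\<close>. The dichotomy is the input of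
  \<open>mu_involution\<close>.\<close>

lemma (in operator_field) two_torsion_cases:
  "(\<forall>x::'a. x + x = 0) \<or> (\<forall>x::'a. (x + x = 0 \<longrightarrow> x = 0) \<and> (\<exists>y. y + y = x))"
proof -
  have K: "(\<lambda>x. x + x) \<in> K" using add_closed[OF id_closed id_closed] by simp
  show ?thesis
  proof (cases "(\<lambda>x. x + x) = (\<lambda>_. 0 :: 'a)")
    case True
    then show ?thesis by meson
  next
    case False
    then show ?thesis using op_eq_zero_iff[OF K False] inv_op_right[OF K False] by blast
  qed
qed

section \<open>The Jordan division algebra over the prime field\<close>

context hua_system
begin

lemma B_additive_right: "Modules.additive (\<lambda>b. B a b x)"
  by (intro additive.intro B_add_right)

lemma B_self: "B a a x = h a x + h a x"
proof -
  have "0 = h (a + - a) x" by (simp add: h_of_zero)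
  also have "\<dots> = h a x + h a x + B a (- a) x" by (simp only: h_sum h_uminus)
  also have "B a (- a) x = - B a a x" by (rule additive.minus[OF B_additive_right])
  finally show ?thesis by simp
qed

lemma h_int_scale: "h (int_scale n a) x = int_scale (n * n) (h a x)"
proof -
  have nat: "h (int_scale (int m) a) x = int_scale (int m * int m) (h a x)" for m
  proof (induction m)
    case 0
    show ?case by (simp add: int_scale_zero h_of_zero)
  next
    case (Suc m)
    have "B a (int_scale (int m) a) x = int_scale (int m) (h a x + h a x)"
      using additive_int_scale[OF B_additive_right[of a x], of "int m" a] by (simp add: B_self)
    then have "h (int_scale (int (Suc m)) a) x =
        h a x + int_scale (int m * int m) (h a x) + int_scale (int m) (h a x + h a x)"
      by (simp add: int_scale_add int_scale_one h_sum Suc)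
    also have "\<dots> = int_scale (1 + int m * int m + int m + int m) (h a x)"
      by (simp only: int_scale_add int_scale_one int_scale_right_add add.assoc)
    also have "1 + int m * int m + int m + int m = int (Suc m) * int (Suc m)" by (simp add: algebra_simps)
    finally show ?case .
  qed
  show ?thesis
    by (cases n rule: int_cases2) (simp_all add: nat int_scale_minus h_uminus)
qed

text \<open>Treats both prime fields at once. \<open>linear\<close> says that additive maps are
  automatically linear, which turns biadditivity of \<open>B\<close> into bilinearity.\<close>

lemma quadratic_jordan:
  assumes R: "field R"
    and add_left: "\<And>r q x. \<lbrakk>r \<in> carrier R; q \<in> carrier R\<rbrakk> \<Longrightarrow> s (r \<oplus>\<^bsub>R\<^esub> q) x = s r x + s q x"
    and mult: "\<And>r q x. \<lbrakk>r \<in> carrier R; q \<in> carrier R\<rbrakk> \<Longrightarrow> s (r \<otimes>\<^bsub>R\<^esub> q) x = s r (s q x)"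
    and one: "\<And>x. s \<one>\<^bsub>R\<^esub> x = x"
    and add_right: "\<And>r x y. r \<in> carrier R \<Longrightarrow> s r (x + y) = s r x + s r y"
    and linear: "\<And>f r x. \<lbrakk>Modules.additive f; r \<in> carrier R\<rbrakk> \<Longrightarrow> f (s r x) = s r (f x)"
    and square: "\<And>r a x. r \<in> carrier R \<Longrightarrow> h (s r a) x = s (r \<otimes>\<^bsub>R\<^esub> r) (h a x)"
  shows "quadratic_jordan_division_algebra R (scaled_group s) h e"
proof -
  let ?J = "scaled_group s"
  have polar: "quad_polar ?J h a b x = B a b x" for a b x
    by (simp add: quad_polar_def scaled_group_minus scaled_group_simps B_def)
  interpret R: field R by (rule R)
  have "module R ?J"
    by (rule moduleI[OF R.is_cring abelian_group_scaled_group])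
      (simp_all add: scaled_group_simps add_left mult one add_right)
  then interpret module R ?J .
  have h_linear: "h a (s r x) = s r (h a x)" if "r \<in> carrier R" for a r x
    using linear[OF h_additive that] .
  have B_linear: "B a (s r b) x = s r (B a b x)" if "r \<in> carrier R" for a b r x
    using linear[OF B_additive_right that] .
  show ?thesis
  proof
    show "quad_V ?J h a b (h a x) = h a (quad_V ?J h b a x)" for a b x
      by (simp add: quad_V_def polar V_commute)
  qed (simp_all add: scaled_group_simps polar B_add_left B_add_right h_linear B_linear
      B_commute[of "s _ _"] B_commute[of _ _] square unit_nonzero h_unit h_fundamental h_add h_bij linear_endos_def)
qed

lemma rational_jordan:
  assumes "torsion_free_uniquely_divisible TYPE('a)"
  shows "quadratic_jordan_division_algebra rat_field (scaled_group rat_scale) h e"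
proof (rule quadratic_jordan[OF field_rat_field])
  show "h (rat_scale q a) x = rat_scale (q \<otimes>\<^bsub>rat_field\<^esub> q) (h a x)" for q a x
  proof -
    obtain m n where mn: "n > 0" "q = of_int m / of_int n" by (rule rat_cases[OF assms])
    have nn: "n * n > 0" using mn by simp
    have "int_scale (n * n) (h (rat_scale q a) x) = int_scale (m * m) (h a x)"
      unfolding h_int_scale[symmetric] rat_scale_eq[OF assms mn] ..
    also have "\<dots> = int_scale (n * n) (rat_scale (q * q) (h a x))"
      using mn by (intro rat_scale_eq[OF assms nn, symmetric]) simp
    finally show ?thesis using int_scale_cancel[OF assms nn] by (simp add: rat_field_def)
  qed
qed (simp_all add: rat_field_def rat_scale_add[OF assms] rat_scale_mult[OF assms] rat_scale_one[OF assms]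
    rat_scale_right_add[OF assms] additive_rat_scale[OF assms])

lemma modular_jordan:
  assumes p: "prime p" and "elementary_abelian p TYPE('a)"
  shows "quadratic_jordan_division_algebra (residue_ring p) (scaled_group int_scale) h e"
proof -
  have zero: "int_scale p (x :: 'a) = 0" for x using assms(2) by (simp add: elementary_abelian_def)
  have mod: "int_scale (k mod p) x = int_scale k x" for k and x :: 'a
  proof -
    have "int_scale k x = int_scale (k div p * p + k mod p) x" by simp
    also have "\<dots> = int_scale (k div p) (int_scale p x) + int_scale (k mod p) x"
      by (simp only: int_scale_add int_scale_mult)
    finally show ?thesis by (simp add: zero additive.zero[OF int_scale_additive])
  qed
  have "p = int (nat p)" "prime (nat p)" using p prime_ge_0_int[OF p] by auto
  then have "field (residue_ring p)"
    using residues_prime.is_field[of "nat p"] by (simp add: residues_prime_def)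
  then show ?thesis
    by (rule quadratic_jordan)
      (simp_all add: residue_ring_def mod int_scale_add int_scale_mult int_scale_one int_scale_right_add
        additive_int_scale h_int_scale)
qed

end

section \<open>\<open>\<mu>\<close>-maps of special Moufang sets\<close>

lemma perm_conj_comp: "bij h \<Longrightarrow> perm_conj (f \<circ> g) h = perm_conj f h \<circ> perm_conj g h"
  by (auto simp: perm_conj_def fun_eq_iff bij_is_inj inv_f_f)

lemma perm_conj_comp_right: "bij g \<Longrightarrow> bij h \<Longrightarrow> perm_conj f (h \<circ> g) = perm_conj (perm_conj f g) h"
  by (simp add: perm_conj_def o_inv_distrib comp_assoc)

lemma perm_conj_id [simp]: "perm_conj f id = f"
  by (simp add: perm_conj_def inv_id)

lemma perm_conj_apply: "bij h \<Longrightarrow> perm_conj f h (h x) = h (f x)"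
  by (simp add: perm_conj_def bij_is_inj inv_f_f)

lemma perm_conj_self: "bij h \<Longrightarrow> perm_conj h h = h"
  by (auto simp: perm_conj_def fun_eq_iff bij_is_surj surj_f_inv_f)

lemma transl_simps [simp]: "transl a None = None" "transl a (Some x) = Some (x + a)"
  by (simp_all add: transl_def)

lemma transl_comp: "transl a \<circ> transl b = transl (a + b :: 'a::ab_group_add)"
  by (auto simp: fun_eq_iff transl_def option.map_comp o_def algebra_simps)

lemma transl_zero [simp]: "transl 0 = id"
  by (auto simp: fun_eq_iff transl_def option.map_ident)

lemma transl_cancel [simp]:
  "transl (- a) (transl (a :: 'a::ab_group_add) x) = x" "transl a (transl (- a) x) = x"
  using transl_comp[of "- a" a] transl_comp[of a "- a"] by (simp_all add: fun_eq_iff)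

lemma transl_eq_iff [simp]:
  "transl (a :: 'a::ab_group_add) x = None \<longleftrightarrow> x = None"
  "transl a x = Some y \<longleftrightarrow> x = Some (y - a)"
  by (cases x; auto simp: algebra_simps)+

definition swaps :: "('a::zero option \<Rightarrow> 'a option) \<Rightarrow> bool"
  where "swaps g \<longleftrightarrow> g None = Some 0 \<and> g (Some 0) = None"

definition fixes_poles :: "('a::zero option \<Rightarrow> 'a option) \<Rightarrow> bool"
  where "fixes_poles g \<longleftrightarrow> g None = None \<and> g (Some 0) = Some 0"

lemma swaps_comp: "swaps f \<Longrightarrow> swaps g \<Longrightarrow> fixes_poles (f \<circ> g)"
  by (simp add: swaps_def fixes_poles_def)

lemma on_U_Some:
  assumes "bij g" "swaps g \<and> x \<noteq> 0 \<or> fixes_poles g"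
  shows "g (Some x) = Some (on_U g x)"
proof -
  have "g (Some x) \<noteq> None"
  proof
    assume none: "g (Some x) = None"
    have "inj g" using assms(1) by (rule bij_is_inj)
    then show False
      using assms(2) none by (metis fixes_poles_def inj_eq option.distinct(1) option.inject swaps_def)
  qed
  then show ?thesis by (simp add: on_U_def)
qed

lemma on_U_nonzero:
  assumes "bij g" "swaps g" "x \<noteq> 0"
  shows "on_U g x \<noteq> 0"
proof
  assume "on_U g x = 0"
  then have "g (Some x) = g None" using on_U_Some[of g x] assms by (simp add: swaps_def)
  then show False using assms(1) by (simp add: bij_is_inj inj_eq)
qed

section \<open>Root groups, automorphisms and factorisations of mu-maps\<close>

locale special_moufang =
  fixes \<tau> :: "'a::ab_group_add option \<Rightarrow> 'a option" and e :: 'a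
  assumes \<tau>_interchanges: "interchanges_0_infty \<tau>"
    and moufang: "moufang_set (root_group \<tau>)"
    and special: "special \<tau>"
    and e_nonzero: "e \<noteq> 0"
    and \<tau>_mu: "\<tau> = mu_map \<tau> e"
begin

abbreviation V where "V \<equiv> root_group \<tau>"
abbreviation V0 where "V0 \<equiv> root_group \<tau> (Some 0)"
abbreviation mu where "mu \<equiv> mu_map \<tau>"

lemma \<tau>_bij: "bij \<tau>" and \<tau>_swaps: "swaps \<tau>"
  using \<tau>_interchanges by (auto simp: interchanges_0_infty_def swaps_def)

lemma transl_in_V: "transl a \<in> V None"
  by simp

lemma V0_eq: "V0 = (\<lambda>b. perm_conj (transl b) \<tau>) ` UNIV"
  by (simp add: image_image)

lemma root_bij: "u \<in> V x \<Longrightarrow> bij u"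
  using moufang subgroup.subset[of "V x" "BijGroup UNIV"]
  by (auto simp: moufang_set_def BijGroup_def Bij_def)

lemma root_fix: "u \<in> V x \<Longrightarrow> u x = x"
  using moufang by (auto simp: moufang_set_def)

lemma root_unique: "\<lbrakk>u \<in> V x; v \<in> V x; y \<noteq> x; u y \<noteq> x; u y = v y\<rbrakk> \<Longrightarrow> u = v"
  using moufang unfolding moufang_set_def by metis

text \<open>The automorphism group of the Moufang set. Membership in it is what makes Hua maps
  additive and conjugates of \<open>mu\<close>-maps again \<open>mu\<close>-maps.\<close>

definition N :: "('a option \<Rightarrow> 'a option) set"
  where "N = {g. bij g \<and> (\<forall>x. (\<lambda>u. perm_conj u g) ` V x = V (g x))}"

lemma N_bij: "g \<in> N \<Longrightarrow> bij g"
  by (simp add: N_def)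

lemma N_conj: "g \<in> N \<Longrightarrow> u \<in> V x \<Longrightarrow> perm_conj u g \<in> V (g x)"
  by (auto simp: N_def)

lemma root_in_N: "u \<in> V x \<Longrightarrow> u \<in> N"
  using moufang root_bij by (auto simp: N_def moufang_set_def)

lemma N_comp: assumes "f \<in> N" "g \<in> N" shows "f \<circ> g \<in> N"
proof -
  have "(\<lambda>u. perm_conj u (f \<circ> g)) ` V x = V (f (g x))" for x
  proof -
    have "(\<lambda>u. perm_conj u (f \<circ> g)) ` V x = (\<lambda>u. perm_conj u f) ` (\<lambda>u. perm_conj u g) ` V x"
      by (simp only: image_image perm_conj_comp_right[OF N_bij N_bij, OF assms(2,1)])
    then show ?thesis using assms by (simp add: N_def)
  qed
  moreover have "bij (f \<circ> g)" by (intro bij_comp N_bij assms)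
  ultimately show ?thesis unfolding N_def mem_Collect_eq comp_apply by blast
qed

text \<open>Such a \<open>g\<close> normalises the group of translations, and the resulting
  translation is recognised by its value at 0.\<close>

lemma N_conj_transl:
  assumes g: "g \<in> N" "fixes_poles g"
  shows "perm_conj (transl a) g = transl (on_U g a)"
proof -
  have "perm_conj (transl a) g \<in> V (g None)" by (rule N_conj[OF g(1) transl_in_V])
  then obtain b where b: "perm_conj (transl a) g = transl b" using g(2) by (auto simp: fixes_poles_def)
  have "transl b (g (Some 0)) = g (transl a (Some 0))"
    unfolding b[symmetric] by (rule perm_conj_apply[OF N_bij[OF g(1)]])
  then have "Some b = g (Some a)" using g(2) by (simp add: fixes_poles_def)
  then show ?thesis unfolding b by (metis on_U_def option.sel)
qed

lemma on_U_add:
  assumes g: "g \<in> N" "fixes_poles g"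
  shows "on_U g (x + y) = on_U g x + on_U g y"
proof -
  have "g (transl y (Some x)) = transl (on_U g y) (g (Some x))"
    using perm_conj_apply[OF N_bij[OF g(1)], of "transl y" "Some x"] by (simp add: N_conj_transl[OF g])
  then show ?thesis using on_U_Some[OF N_bij[OF g(1)]] g(2) by simp
qed

text \<open>Specialness turns the last translation in \<open>mu_map\<close> into one by
  \<open>a\<close>, equal to the first.\<close>

lemma mu_decomposition:
  assumes a: "a \<noteq> 0"
  shows "\<exists>v\<in>V0. mu a = transl a \<circ> v \<circ> transl a \<and> v None = Some (- a) \<and> v (Some a) = None"
proof -
  define c where "c = on_U (inv_into UNIV \<tau>) a"
  have \<tau>c': "\<tau> (inv_into UNIV \<tau> (Some a)) = Some a"
    using \<tau>_bij by (simp add: bij_is_surj surj_f_inv_f)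
  then have "inv_into UNIV \<tau> (Some a) \<noteq> None" using a \<tau>_swaps by (metis option.inject swaps_def)
  then have c: "inv_into UNIV \<tau> (Some a) = Some c" by (simp add: c_def on_U_def)
  then have \<tau>c: "\<tau> (Some c) = Some a" using \<tau>c' by simp
  then have c0: "c \<noteq> 0" using \<tau>_swaps by (auto simp: swaps_def)
  have neg: "on_U \<tau> (- c) = - a"
    using special c0 \<tau>c by (simp add: special_def on_U_def)
  have "mu a = transl a \<circ> perm_conj (transl (- c)) \<tau> \<circ> transl a"
    using neg by (simp add: mu_map_def c_def Let_def)
  moreover have "perm_conj (transl (- c)) \<tau> \<in> V0" unfolding V0_eq by auto
  moreover have "perm_conj (transl (- c)) \<tau> None = Some (- a)"
    using perm_conj_apply[OF \<tau>_bij, of "transl (- c)" "Some 0"] neg on_U_Some[OF \<tau>_bij, of "- c"] \<tau>_swaps c0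
    by (simp add: swaps_def)
  moreover have "perm_conj (transl (- c)) \<tau> (Some a) = None"
    using perm_conj_apply[OF \<tau>_bij, of "transl (- c)" "Some c"] \<tau>c \<tau>_swaps by (simp add: swaps_def)
  ultimately show ?thesis by blast
qed

lemma mu_in_N: "a \<noteq> 0 \<Longrightarrow> mu a \<in> N"
proof -
  assume "a \<noteq> 0"
  then obtain v where v: "v \<in> V0" "mu a = transl a \<circ> v \<circ> transl a" using mu_decomposition by blast
  show ?thesis unfolding v(2) by (intro N_comp root_in_N[OF v(1)] root_in_N[OF transl_in_V])
qed

lemma mu_bij: "a \<noteq> 0 \<Longrightarrow> bij (mu a)"
  using mu_in_N N_bij by blast

lemma mu_swaps: "a \<noteq> 0 \<Longrightarrow> swaps (mu a)"
  using mu_decomposition[of a] by (auto simp: swaps_def)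

lemma \<tau>_in_N: "\<tau> \<in> N"
  using mu_in_N[OF e_nonzero] \<tau>_mu by simp

text \<open>By regularity an element of the root group of 0 is determined by its image of infinity.
  This recognises \<open>mu a\<close> without reference to \<open>\<tau>\<close>.\<close>

lemma mu_uniqueness:
  assumes a: "a \<noteq> 0" and v: "v \<in> V0" and sw: "swaps (transl a \<circ> v \<circ> transl b)"
  shows "transl a \<circ> v \<circ> transl b = mu a"
proof -
  obtain w where w: "w \<in> V0" "mu a = transl a \<circ> w \<circ> transl a" "w None = Some (- a)" "w (Some a) = None"
    using mu_decomposition[OF a] by blast
  have vN: "v None = Some (- a)" and vb: "v (Some b) = None" using sw by (auto simp: swaps_def)
  have vw: "v = w" using a vN w(3) by (intro root_unique[OF v w(1), of None]) auto
  then have "v (Some b) = v (Some a)" using vb w(4) by simp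
  then have "b = a" using root_bij[OF v] by (simp add: bij_is_inj inj_eq)
  then show ?thesis using w(2) vw by simp
qed

text \<open>Conjugation by \<open>mu a\<close> fixes \<open>mu a\<close> and exchanges the root
  groups of 0 and infinity, so it turns the factorisation of \<open>mu_decomposition\<close> into
  this one.\<close>

lemma mu_decomposition_dual:
  assumes a: "a \<noteq> 0"
  shows "\<exists>v\<in>V0. mu a = v \<circ> transl a \<circ> v \<and> v None = Some (- a) \<and> v (Some a) = None"
proof -
  obtain w where w: "w \<in> V0" "mu a = transl a \<circ> w \<circ> transl a" "w None = Some (- a)" "w (Some a) = None"
    using mu_decomposition[OF a] by blast
  have sw: "mu a None = Some 0" "mu a (Some 0) = None" using mu_swaps[OF a] by (auto simp: swaps_def)
  define v where "v = perm_conj (transl a) (mu a)"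
  have v: "v \<in> V0" using N_conj[OF mu_in_N[OF a] transl_in_V, of a] sw by (simp add: v_def)
  have "perm_conj w (mu a) \<in> V None" using N_conj[OF mu_in_N[OF a] w(1)] sw by simp
  then obtain f where f: "perm_conj w (mu a) = transl f" by auto
  have "mu a (Some (- a)) = Some a" using w(2) root_fix[OF w(1)] by simp
  then have "f = a"
    using perm_conj_apply[OF mu_bij[OF a], of w None] by (simp add: f sw w(3))
  then have "mu a = v \<circ> transl a \<circ> v"
    using perm_conj_self[OF mu_bij[OF a]] f
    by (metis v_def w(2) perm_conj_comp[OF mu_bij[OF a]])
  moreover from this have "v None = Some (- a) \<and> v (Some a) = None"
  proof -
    assume eq: "mu a = v \<circ> transl a \<circ> v"
    have "v (transl a (v None)) = v (Some 0)" using sw eq root_fix[OF v] by simp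
    then have "transl a (v None) = Some 0" using root_bij[OF v] by (simp add: bij_is_inj inj_eq)
    moreover have "v (Some a) = None" using sw eq root_fix[OF v] by simp
    ultimately show ?thesis by simp
  qed
  ultimately show ?thesis using v by blast
qed

lemma mu_uniqueness_dual:
  assumes f: "f \<noteq> 0" and v: "v \<in> V0" "w \<in> V0" and sw: "swaps (v \<circ> transl f \<circ> w)"
  shows "v \<circ> transl f \<circ> w = mu f"
proof -
  obtain z where z: "z \<in> V0" "mu f = z \<circ> transl f \<circ> z" "z None = Some (- f)" "z (Some f) = None"
    using mu_decomposition_dual[OF f] by blast
  have "v (transl f (w None)) = v (Some 0)" using sw root_fix[OF v(1)] by (simp add: swaps_def)
  then have "transl f (w None) = Some 0" using root_bij[OF v(1)] by (simp add: bij_is_inj inj_eq)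
  then have "w = z" using f z(3) by (intro root_unique[OF v(2) z(1), of None]) auto
  moreover have "v (Some f) = None" using sw root_fix[OF v(2)] by (simp add: swaps_def)
  then have "v = z" using f z(4) by (intro root_unique[OF v(1) z(1), of "Some f"]) auto
  ultimately show ?thesis using z(2) by simp
qed

lemma swaps_conj:
  assumes "bij g" "swaps g \<or> fixes_poles g" "swaps f"
  shows "swaps (perm_conj f g)"
proof -
  have "perm_conj f g (g None) = g (f None)" "perm_conj f g (g (Some 0)) = g (f (Some 0))"
    using perm_conj_apply[OF assms(1)] by auto
  then show ?thesis using assms(2,3) by (auto simp: swaps_def fixes_poles_def)
qed

lemma conj_mu_fixing:
  assumes g: "g \<in> N" "fixes_poles g" and a: "a \<noteq> 0"
  shows "perm_conj (mu a) g = mu (on_U g a)"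
proof -
  note gb = N_bij[OF g(1)]
  obtain w where w: "w \<in> V0" "mu a = transl a \<circ> w \<circ> transl a" using mu_decomposition[OF a] by blast
  have eq: "perm_conj (mu a) g = transl (on_U g a) \<circ> perm_conj w g \<circ> transl (on_U g a)"
    unfolding w(2) perm_conj_comp[OF gb] N_conj_transl[OF g] ..
  have "on_U g a \<noteq> 0"
  proof
    assume "on_U g a = 0"
    then have "g (Some a) = g (Some 0)" using on_U_Some[OF gb, of a] g(2) by (simp add: fixes_poles_def)
    then show False using gb a by (simp add: bij_is_inj inj_eq)
  qed
  moreover have "perm_conj w g \<in> V0" using N_conj[OF g(1) w(1)] g(2) by (simp add: fixes_poles_def)
  moreover have "swaps (perm_conj (mu a) g)" using swaps_conj[OF gb] g(2) mu_swaps[OF a] by blast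
  ultimately show ?thesis unfolding eq by (rule mu_uniqueness)
qed

text \<open>The sign comes from the middle factor: \<open>w\<close> sends infinity to - a, so its
  conjugate is the translation by the image of - a.\<close>

lemma conj_mu_swapping:
  assumes g: "g \<in> N" "swaps g" and a: "a \<noteq> 0"
  shows "perm_conj (mu a) g = mu (on_U g (- a))"
proof -
  note gb = N_bij[OF g(1)]
  obtain w where w: "w \<in> V0" "mu a = transl a \<circ> w \<circ> transl a" "w None = Some (- a)"
    using mu_decomposition[OF a] by blast
  have "perm_conj w g \<in> V None" using N_conj[OF g(1) w(1)] g(2) by (simp add: swaps_def)
  then obtain f where f: "perm_conj w g = transl f" by auto
  have "perm_conj w g (g None) = g (Some (- a))" using perm_conj_apply[OF gb] w(3) by simp
  then have "g (Some (- a)) = Some f" using g(2) by (simp add: f swaps_def)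
  then have f': "f = on_U g (- a)" by (simp add: on_U_def)
  have eq: "perm_conj (mu a) g = perm_conj (transl a) g \<circ> transl f \<circ> perm_conj (transl a) g"
    unfolding w(2) perm_conj_comp[OF gb] f ..
  have "perm_conj (transl a) g \<in> V0" using N_conj[OF g(1) transl_in_V] g(2) by (simp add: swaps_def)
  moreover have "f \<noteq> 0" unfolding f' using on_U_nonzero[OF gb g(2)] a by simp
  moreover have "swaps (perm_conj (mu a) g)" using swaps_conj[OF gb] g(2) mu_swaps[OF a] by blast
  ultimately show ?thesis unfolding eq f'[symmetric] by (intro mu_uniqueness_dual)
qed

lemma mu_uminus_comp:
  assumes a: "a \<noteq> 0"
  shows "mu (- a) \<circ> mu a = id" "mu a \<circ> mu (- a) = id"
proof -
  obtain w where w: "w \<in> V0" "mu a = transl a \<circ> w \<circ> transl a" "w None = Some (- a)" "w (Some a) = None"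
    using mu_decomposition[OF a] by blast
  obtain b where b: "w = perm_conj (transl b) \<tau>" using w(1) unfolding V0_eq by auto
  define w' where "w' = perm_conj (transl (- b)) \<tau>"
  have w': "w' \<in> V0" unfolding w'_def V0_eq by auto
  have "perm_conj (transl x \<circ> transl y) \<tau> = id" if "x + y = 0" for x y
    using that \<tau>_bij by (auto simp: transl_comp perm_conj_def fun_eq_iff bij_is_surj surj_f_inv_f)
  then have "w' \<circ> w = id" "w \<circ> w' = id"
    unfolding b w'_def perm_conj_comp[OF \<tau>_bij, symmetric] by simp_all
  then have ww: "w' (w x) = x" "w (w' x) = x" for x by (auto dest: pointfree_idE)
  let ?m = "transl (- a) \<circ> w' \<circ> transl (- a)"
  have "w' None = Some a" "w' (Some (- a)) = None" using ww w(3,4) by metis+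
  then have "swaps ?m" by (simp add: swaps_def)
  then have m: "?m = mu (- a)" using a by (intro mu_uniqueness[OF _ w']) auto
  show "mu (- a) \<circ> mu a = id" "mu a \<circ> mu (- a) = id"
    unfolding m[symmetric] w(2) by (auto simp: fun_eq_iff ww)
qed

lemma inv_mu: "a \<noteq> 0 \<Longrightarrow> inv_into UNIV (mu a) = mu (- a)"
  by (rule inv_unique_comp[OF mu_uminus_comp(2) mu_uminus_comp(1)])

section \<open>The mu-maps on nonzero vectors\<close>

definition M :: "'a \<Rightarrow> 'a \<Rightarrow> 'a" where "M a = on_U (mu a)"

lemma mu_Some: "a \<noteq> 0 \<Longrightarrow> x \<noteq> 0 \<Longrightarrow> mu a (Some x) = Some (M a x)"
  unfolding M_def by (intro on_U_Some mu_bij disjI1 conjI mu_swaps)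

lemma M_nonzero: "a \<noteq> 0 \<Longrightarrow> x \<noteq> 0 \<Longrightarrow> M a x \<noteq> 0"
  unfolding M_def by (intro on_U_nonzero mu_bij mu_swaps)

lemma M_cancel: assumes "a \<noteq> 0" "x \<noteq> 0" shows "M (- a) (M a x) = x" "M a (M (- a) x) = x"
proof -
  have "mu (- a) (mu a (Some x)) = Some x" "mu a (mu (- a) (Some x)) = Some x"
    using pointfree_idE[OF mu_uminus_comp(1)[OF assms(1)]]
      pointfree_idE[OF mu_uminus_comp(2)[OF assms(1)]] by simp_all
  then show "M (- a) (M a x) = x" "M a (M (- a) x) = x"
    using assms M_nonzero[of a x] M_nonzero[of "- a" x] by (simp_all add: mu_Some)
qed

text \<open>Specialness speaks of \<open>\<tau>\<close> alone. Oddness passes to every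
  \<open>mu b\<close> because \<open>mu b \<circ> \<tau>\<close> is additive.\<close>

lemma M_odd: assumes b: "b \<noteq> 0" and x: "x \<noteq> 0" shows "M b (- x) = - M b x"
proof -
  define t where "t = on_U (inv_into UNIV \<tau>) x"
  have \<tau>t': "\<tau> (inv_into UNIV \<tau> (Some x)) = Some x"
    using \<tau>_bij by (simp add: bij_is_surj surj_f_inv_f)
  then have "inv_into UNIV \<tau> (Some x) \<noteq> None" using x \<tau>_swaps by (metis option.inject swaps_def)
  then have "inv_into UNIV \<tau> (Some x) = Some t" by (simp add: t_def on_U_def)
  then have \<tau>t: "\<tau> (Some t) = Some x" using \<tau>t' by simp
  then have t0: "t \<noteq> 0" using \<tau>_swaps by (auto simp: swaps_def)
  have "on_U \<tau> (- t) = - x" using special t0 \<tau>t by (simp add: special_def on_U_def)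
  then have \<tau>t2: "\<tau> (Some (- t)) = Some (- x)" using on_U_Some[OF \<tau>_bij, of "- t"] \<tau>_swaps t0 by simp
  define g where "g = mu b \<circ> \<tau>"
  have g: "g \<in> N" "fixes_poles g"
    unfolding g_def using N_comp[OF mu_in_N[OF b] \<tau>_in_N] swaps_comp[OF mu_swaps[OF b] \<tau>_swaps] by auto
  have "on_U g 0 = 0" using g(2) by (simp add: fixes_poles_def on_U_def)
  then have "on_U g t + on_U g (- t) = 0" using on_U_add[OF g, of t "- t"] by simp
  moreover have "on_U g t = M b x" "on_U g (- t) = M b (- x)"
    by (simp_all add: g_def M_def on_U_def \<tau>t \<tau>t2)
  ultimately show ?thesis by (simp add: eq_neg_iff_add_eq_0 add.commute)
qed

lemma M_self: assumes a: "a \<noteq> 0" shows "M a a = - a"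
proof -
  obtain w where w: "w \<in> V0" "mu a = transl a \<circ> w \<circ> transl a"
    using mu_decomposition[OF a] by blast
  have "mu a (Some (- a)) = Some a" using w(2) root_fix[OF w(1)] by simp
  then have "M a (- a) = a" by (simp add: M_def on_U_def)
  then show ?thesis using M_odd[OF a a] by (metis minus_minus)
qed

text \<open>The maps \<open>mu a\<close> do not depend on the choice of \<open>\<tau>\<close>; here \<open>\<tau>\<close> is replaced by
  \<open>mu b\<close>.\<close>

lemma M_formula:
  assumes b: "b \<noteq> 0" and a: "a \<noteq> 0" and x: "x \<noteq> 0" "x + a \<noteq> 0"
  shows "M a x = M b (M (- b) (x + a) - M (- b) a) + a"
proof -
  define c where "c = M (- b) a"
  have c: "M b c = a" "c \<noteq> 0" using M_cancel[OF b a] M_nonzero a b by (auto simp: c_def)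
  define v where "v = perm_conj (transl (- c)) (mu b)"
  have sw: "mu b None = Some 0" "mu b (Some 0) = None" using mu_swaps[OF b] by (auto simp: swaps_def)
  have v: "v \<in> V0" using N_conj[OF mu_in_N[OF b] transl_in_V, of "- c"] by (simp add: v_def sw)
  have v_eq: "v (mu b y) = mu b (transl (- c) y)" for y
    unfolding v_def by (rule perm_conj_apply[OF mu_bij[OF b]])
  have "v None = Some (- a)"
    using v_eq[of "Some 0"] c mu_Some[OF b, of "- c"] by (simp add: sw M_odd[OF b])
  moreover have "v (Some a) = None"
    using v_eq[of "Some c"] c mu_Some[OF b c(2)] by (simp add: sw)
  ultimately have "swaps (transl a \<circ> v \<circ> transl a)" by (simp add: swaps_def)
  then have mu: "mu a = transl a \<circ> v \<circ> transl a" using mu_uniqueness[OF a v] by simp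
  define y where "y = M (- b) (x + a)"
  have y: "M b y = x + a" "y \<noteq> 0" using M_cancel[OF b x(2)] M_nonzero x(2) b by (auto simp: y_def)
  have yc: "y - c \<noteq> 0" using y c x(1) by auto
  have "mu b (Some y) = Some (x + a)" using mu_Some[OF b y(2)] y(1) by simp
  then have "v (Some (x + a)) = mu b (Some (y - c))" using v_eq[of "Some y"] by simp
  then have "mu a (Some x) = Some (M b (y - c) + a)" using mu_Some[OF b yc] by (simp add: mu)
  then show ?thesis by (simp add: M_def[of a] on_U_def y_def c_def)
qed

section \<open>Products of root elements and squares of mu-maps\<close>

lemma \<tau>_preimage:
  assumes "x \<noteq> 0" obtains p where "p \<noteq> 0" "\<tau> (Some p) = Some x"
proof -
  have "\<tau> (Some (M (- e) x)) = Some x"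
    using mu_Some[OF e_nonzero M_nonzero, of "- e" x] M_cancel(2)[OF e_nonzero assms] assms e_nonzero
    by (simp flip: \<tau>_mu)
  then show ?thesis using that M_nonzero[of "- e" x] assms e_nonzero by auto
qed

lemma \<tau>_minus:
  assumes "p \<noteq> 0" "\<tau> (Some p) = Some x" shows "\<tau> (Some (- p)) = Some (- x)"
  using special assms on_U_Some[OF \<tau>_bij, of "- p"] \<tau>_swaps by (simp add: special_def on_U_def)

text \<open>Expresses an element of the root group of 0 by a \<open>mu\<close>-map and translations,
  so that multiplication in that group becomes a relation between \<open>mu\<close>-maps.\<close>

lemma mu_via_\<tau>:
  assumes x: "x \<noteq> 0" and p: "p \<noteq> 0" "\<tau> (Some p) = Some x"
  shows "perm_conj (transl (- p)) \<tau> u = transl (- x) (mu x (transl (- x) u))"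
proof -
  let ?v = "perm_conj (transl (- p)) \<tau>"
  have "?v \<in> V0" unfolding V0_eq by auto
  moreover have "?v None = Some (- x)"
    using perm_conj_apply[OF \<tau>_bij, of "transl (- p)" "Some 0"] \<tau>_minus[OF p] \<tau>_swaps by (simp add: swaps_def)
  moreover have "?v (Some x) = None"
    using perm_conj_apply[OF \<tau>_bij, of "transl (- p)" "Some p"] p \<tau>_swaps by (simp add: swaps_def)
  ultimately have "transl x \<circ> ?v \<circ> transl x = mu x"
    by (intro mu_uniqueness[OF x]) (auto simp: swaps_def)
  then have "mu x (transl (- x) u) = transl x (?v u)" by (metis comp_apply transl_cancel(2))
  then show ?thesis by simp
qed

text \<open>Multiply the root elements with parameters p and q by \<open>mu_via_\<tau>\<close>. The
  translation by w = - x - y in the middle is z^{-1} \<open>mu w\<close> z^{-1} for some z in the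
  root group of 0, and moving z^{-1} past \<open>mu x\<close> and \<open>mu y\<close> turns it into
  translations at the two ends.\<close>

lemma mu_sum:
  assumes x: "x \<noteq> 0" "p \<noteq> 0" "\<tau> (Some p) = Some x"
    and y: "y \<noteq> 0" "q \<noteq> 0" "\<tau> (Some q) = Some y"
    and c: "c \<noteq> 0" "p + q \<noteq> 0" "\<tau> (Some (p + q)) = Some c"
    and xy: "x + y \<noteq> 0"
  shows "mu c = mu y \<circ> mu (- x - y) \<circ> mu x"
proof -
  define w where "w = - x - y"
  have w: "w \<noteq> 0"
  proof
    assume "w = 0"
    then have "- (x + y) = 0" by (simp add: w_def)
    then show False using xy by (simp only: neg_equal_0_iff_equal)
  qed
  have mx: "- x \<noteq> 0" using x(1) by simp
  obtain z where z: "z \<in> V0" "mu w = z \<circ> transl w \<circ> z" using mu_decomposition_dual[OF w] by blast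
  obtain b where b: "z = perm_conj (transl b) \<tau>" using z(1) unfolding V0_eq by auto
  define z' where "z' = perm_conj (transl (- b)) \<tau>"
  have z': "z' \<in> V0" unfolding z'_def V0_eq by auto
  have "perm_conj (transl i \<circ> transl j) \<tau> = id" if "i + j = 0" for i j
    using that \<tau>_bij by (auto simp: transl_comp perm_conj_def fun_eq_iff bij_is_surj surj_f_inv_f)
  then have "z' \<circ> z = id" "z \<circ> z' = id"
    unfolding b z'_def perm_conj_comp[OF \<tau>_bij, symmetric] by simp_all
  then have zz: "z' (z u) = u" "z (z' u) = u" for u by (auto dest: pointfree_idE)
  have Aw: "transl w u = z' (mu w (z' u))" for u by (simp add: z(2) zz)
  have sw: "mu a None = Some 0" "mu a (Some 0) = None" if "a \<noteq> 0" for a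
    using mu_swaps[OF that] by (auto simp: swaps_def)
  have "perm_conj z' (mu y) \<in> V None" using N_conj[OF mu_in_N[OF y(1)] z'] sw[OF y(1)] by simp
  then obtain s where "perm_conj z' (mu y) = transl s" by auto
  then have s: "mu y (z' u) = transl s (mu y u)" for u
    using perm_conj_apply[OF mu_bij[OF y(1)], of z' u] by simp
  have "perm_conj z' (mu (- x)) \<in> V None" using N_conj[OF mu_in_N[OF mx] z'] sw[OF mx] by simp
  then obtain r where r': "perm_conj z' (mu (- x)) = transl r" by auto
  have r: "z' (mu x u) = mu x (transl r u)" for u
    using perm_conj_apply[OF mu_bij[OF mx], of z' "mu x u"] pointfree_idE[OF mu_uminus_comp(1)[OF x(1)]]
      pointfree_idE[OF mu_uminus_comp(2)[OF x(1)]] by (simp add: r')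
  have trans: "transl i (transl j u) = transl (i + j) u" for i j :: 'a and u
    using fun_cong[OF transl_comp, of i j u] by simp
  have "mu c u = transl (c - y + s) (mu y (mu w (mu x (transl (r + (c - x)) u))))" for u
  proof -
    have "transl (- p) \<circ> transl (- q) = transl (- (p + q))" by (simp add: transl_comp)
    then have "transl (- c) (mu c (transl (- c) u')) =
        transl (- y) (mu y (transl (- y) (transl (- x) (mu x (transl (- x) u')))))" for u'
      using fun_cong[OF perm_conj_comp[OF \<tau>_bij, of "transl (- q)" "transl (- p)"], of u']
      by (simp add: transl_comp add.commute mu_via_\<tau>[OF x] mu_via_\<tau>[OF y] flip: mu_via_\<tau>[OF c])
    then have "transl (- c) (mu c u) =
        transl (- y) (mu y (transl (- y) (transl (- x) (mu x (transl (- x) (transl c u))))))"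
      by (metis transl_cancel(1))
    then have "transl c (transl (- c) (mu c u)) =
        transl c (transl (- y) (mu y (transl w (mu x (transl (c - x) u)))))"
      by (simp add: trans w_def algebra_simps del: transl_cancel)
    then show ?thesis by (simp add: trans Aw s r algebra_simps)
  qed
  then have mu_c: "mu c u = transl (c - y + s) (mu y (mu w (mu x (transl (r + (c - x)) u))))" for u .
  \<comment> \<open>The outer translations are trivial: compare the values at infinity, then at
    0.\<close>
  have 1: "c - y + s = 0"
    using mu_c[of None] by (simp add: sw x y w c)
  have inj: "inj (mu y)" "inj (mu w)" "inj (mu x)" using mu_bij x y w bij_is_inj by blast+
  have "mu y (mu w (mu x (Some (r + (c - x))))) = mu y (mu w (mu x (Some 0)))"
    using mu_c[of "Some 0"] 1 by (simp add: sw x y w c)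
  then have 2: "r + (c - x) = 0" using inj by (simp add: inj_eq)
  show ?thesis using mu_c unfolding 1 2 by (auto simp: w_def)
qed

text \<open>The root group of 0 is abelian, so \<open>mu_sum\<close> also applies with x and y
  exchanged.\<close>

lemma mu_triple:
  assumes x: "x \<noteq> 0" and y: "y \<noteq> 0" and xy: "x + y \<noteq> 0"
  shows "mu y \<circ> mu (- x - y) \<circ> mu x = mu x \<circ> mu (- x - y) \<circ> mu y"
proof -
  obtain p where p: "p \<noteq> 0" "\<tau> (Some p) = Some x" using \<tau>_preimage[OF x] by blast
  obtain q where q: "q \<noteq> 0" "\<tau> (Some q) = Some y" using \<tau>_preimage[OF y] by blast
  have pq: "p + q \<noteq> 0"
  proof
    assume "p + q = 0"
    then have "q = - p" by (simp add: eq_neg_iff_add_eq_0 add.commute)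
    then have "y = - x" using \<tau>_minus[OF p] q(2) by simp
    then show False using xy by simp
  qed
  define c where "c = on_U \<tau> (p + q)"
  have c: "\<tau> (Some (p + q)) = Some c" "c \<noteq> 0"
    using on_U_Some[OF \<tau>_bij] on_U_nonzero[OF \<tau>_bij] \<tau>_swaps pq by (auto simp: c_def)
  have "mu c = mu y \<circ> mu (- x - y) \<circ> mu x"
    by (rule mu_sum[OF x p y q c(2) pq c(1) xy])
  moreover have "mu c = mu x \<circ> mu (- y - x) \<circ> mu y"
    by (rule mu_sum[OF y q x p c(2)]) (use pq c(1) xy in \<open>simp_all add: add.commute\<close>)
  moreover have "- y - x = - x - y" by (simp only: diff_conv_add_uminus add.commute)
  ultimately show ?thesis by simp
qed

text \<open>Factor \<open>mu c\<close> as \<open>mu x \<circ> mu w \<circ> mu y\<close> with x + y +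
  w = 0. Moving \<open>mu y\<close> through the first two factors exchanges them, by
  \<open>mu_triple\<close> for w and y; a second pass, for x and y, restores their order.\<close>

lemma mu_square_centralises:
  assumes y: "y \<noteq> 0" and c: "c \<noteq> 0" "c \<noteq> y"
  shows "mu y \<circ> mu y \<circ> mu c = mu c \<circ> (mu y \<circ> mu y)"
proof -
  obtain q where q: "q \<noteq> 0" "\<tau> (Some q) = Some y" using \<tau>_preimage[OF y] by blast
  obtain r where r: "r \<noteq> 0" "\<tau> (Some r) = Some c" using \<tau>_preimage[OF c(1)] by blast
  define p where "p = r - q"
  have p: "p \<noteq> 0" using q r c(2) by (auto simp: p_def)
  define x where "x = on_U \<tau> p"
  have x: "\<tau> (Some p) = Some x" "x \<noteq> 0"
    using on_U_Some[OF \<tau>_bij] on_U_nonzero[OF \<tau>_bij] \<tau>_swaps p by (auto simp: x_def)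
  have xy: "x + y \<noteq> 0"
  proof
    assume "x + y = 0"
    then have "\<tau> (Some p) = \<tau> (Some (- q))" using \<tau>_minus[OF q] x(1) by (simp add: eq_neg_iff_add_eq_0)
    then have "p = - q" using \<tau>_bij by (simp add: bij_is_inj inj_eq)
    then show False using r(1) by (simp add: p_def)
  qed
  define w where "w = - x - y"
  have w: "w \<noteq> 0" "w + y \<noteq> 0" "- w - y = x"
    using x(2) xy by (auto simp: w_def algebra_simps neg_eq_iff_add_eq_0)
  have pq: "q + p = r" by (simp add: p_def)
  have "mu c = mu x \<circ> mu (- y - x) \<circ> mu y"
    by (rule mu_sum[OF y q x(2) p x(1) c(1)]) (use pq r xy in \<open>simp_all add: add.commute\<close>)
  moreover have "- y - x = w" unfolding w_def by (simp only: diff_conv_add_uminus add.commute)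
  ultimately have mc: "mu c u = mu x (mu w (mu y u))" for u by simp
  have t1: "mu y (mu w (mu x u)) = mu x (mu w (mu y u))" for u
    using fun_cong[OF mu_triple[OF x(2) y xy], of u] by (simp add: w_def)
  have t2: "mu y (mu x (mu w u)) = mu w (mu x (mu y u))" for u
    using fun_cong[OF mu_triple[OF w(1) y w(2)], of u] by (simp add: w(3))
  show ?thesis by (auto simp: mc t1 t2)
qed

text \<open>\<open>M_formula\<close> with both arguments equal to x, where \<open>M_self\<close>
  gives the left-hand side. It is the rule (2 x)^{-1} = x^{-1} / 2 without division.\<close>

lemma M_double:
  assumes b: "b \<noteq> 0" and x: "x \<noteq> 0" "x + x \<noteq> 0"
  shows "M (- b) (x + x) + M (- b) (x + x) = M (- b) x"
proof -
  define d where "d = M (- b) (x + x) - M (- b) x"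
  have mb: "- b \<noteq> 0" using b by simp
  have "d \<noteq> 0"
  proof
    assume "d = 0"
    then have "M b (M (- b) (x + x)) = M b (M (- b) x)" by (simp add: d_def)
    then show False using M_cancel(2)[OF b] x by simp
  qed
  have "- x = M b d + x" using M_formula[OF b x(1) x] M_self[OF x(1)] by (simp add: d_def)
  then have "M b d = - (x + x)" by (metis add_diff_cancel minus_add_distrib diff_conv_add_uminus)
  then have "M (- b) (- (x + x)) = d" using M_cancel(1)[OF b \<open>d \<noteq> 0\<close>] by simp
  then show ?thesis using M_odd[OF mb x(2)] by (simp add: d_def algebra_simps)
qed

text \<open>For s = a + b nonzero, evaluating the common map at a both by \<open>M_self\<close> and
  by \<open>M_formula\<close> with base b gives 2 M (- b) s = - b. With s = 2 x,
  \<open>M_double\<close> yields M (- b) x = - b, hence x = b.\<close>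

lemma mu_eqD:
  assumes ab: "a \<noteq> 0" "b \<noteq> 0" "mu a = mu b" and halves: "\<And>x::'a. \<exists>y. y + y = x"
  shows "a = b \<or> a = - b"
proof (rule disjCI)
  assume neq: "a \<noteq> - b"
  define s where "s = a + b"
  have s: "s \<noteq> 0" using neq by (auto simp: s_def eq_neg_iff_add_eq_0)
  have mb: "- b \<noteq> 0" using ab by simp
  have Mbb: "M (- b) b = - b" using M_self[OF mb] M_odd[OF mb ab(2)] by (metis minus_minus)
  define d where "d = M (- b) s + b"
  have "d \<noteq> 0"
  proof
    assume "d = 0"
    then have "M (- b) s = M (- b) b" unfolding Mbb by (simp add: d_def eq_neg_iff_add_eq_0)
    then have "s = b" using M_cancel(2)[OF ab(2)] s ab(2) by metis
    then show False using ab(1) by (simp add: s_def)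
  qed
  have "- a = M b a" using M_self[OF ab(1)] ab(3) by (simp add: M_def)
  also have "\<dots> = M b d + b"
    using M_formula[OF ab(2) ab(2) ab(1)] s by (simp add: d_def Mbb s_def)
  finally have "M b d = - s" by (simp add: s_def algebra_simps)
  then have "M (- b) (- s) = d" using M_cancel(1)[OF ab(2) \<open>d \<noteq> 0\<close>] by simp
  then have ss: "M (- b) s + M (- b) s = - b" using M_odd[OF mb s]
    by (simp add: d_def neg_eq_iff_add_eq_0 eq_neg_iff_add_eq_0 ac_simps)
  obtain x where x: "x + x = s" using halves by blast
  have x0: "x \<noteq> 0" using x s by auto
  have "M (- b) x = - b" using M_double[OF ab(2) x0] x s ss by simp
  then have "x = b" using M_cancel(2)[OF ab(2) x0] M_odd[OF ab(2) ab(2)] M_self[OF ab(2)] by simp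
  then show "a = b" using x by (simp add: s_def)
qed

text \<open>The square \<open>Z\<close> of \<open>mu y\<close> centralises every \<open>mu c = mu (Z c)\<close>, so \<open>Z\<close> is an automorphism of
  \<open>U\<close> that fixes \<open>y\<close> and maps each \<open>c\<close> to \<open>c\<close> or \<open>- c\<close>.\<close>

lemma mu_involution:
  assumes two: "(\<forall>x::'a. x + x = 0) \<or> (\<forall>x::'a. (x + x = 0 \<longrightarrow> x = 0) \<and> (\<exists>y. y + y = x))"
    and y: "y \<noteq> 0"
  shows "mu y \<circ> mu y = id"
  using two
proof
  assume "\<forall>x::'a. x + x = 0"
  then have "- y = y" by (metis add.right_neutral neg_eq_iff_add_eq_0)
  then show ?thesis using mu_uminus_comp(1)[OF y] by simp
next
  assume two: "\<forall>x::'a. (x + x = 0 \<longrightarrow> x = 0) \<and> (\<exists>y. y + y = x)"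
  let ?Z = "mu y \<circ> mu y"
  have Z: "?Z \<in> N" "fixes_poles ?Z"
    using N_comp[OF mu_in_N[OF y] mu_in_N[OF y]] swaps_comp[OF mu_swaps[OF y] mu_swaps[OF y]] by auto
  note Zb = N_bij[OF Z(1)]
  have Zy: "on_U ?Z y = y"
    using mu_Some[OF y] y M_self[OF y] M_odd[OF y y] by (simp add: on_U_def)
  have Z_minus: "on_U ?Z (- y) = - y"
    using mu_Some[OF y] y M_self[OF y] M_odd[OF y y] by (simp add: on_U_def)
  have pm: "on_U ?Z c = c \<or> on_U ?Z c = - c" if c: "c \<noteq> 0" "c \<noteq> y" for c
  proof -
    have "perm_conj (mu c) ?Z = mu c \<circ> ?Z \<circ> inv_into UNIV ?Z"
      unfolding perm_conj_def using mu_square_centralises[OF y c] by simp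
    also have "\<dots> = mu c" using Zb by (auto simp: fun_eq_iff bij_is_surj surj_f_inv_f simp del: comp_apply simp: comp_apply[of "mu c \<circ> ?Z"] comp_apply[of "mu c"])
    finally have "mu (on_U ?Z c) = mu c" using conj_mu_fixing[OF Z c(1)] by simp
    moreover have "on_U ?Z c \<noteq> 0"
      using M_nonzero[OF y M_nonzero[OF y c(1)]] mu_Some[OF y] M_nonzero[OF y] c(1) by (simp add: on_U_def)
    ultimately show ?thesis using mu_eqD c(1) two by blast
  qed
  have Zc: "on_U ?Z c = c" for c
  proof (rule ccontr)
    assume neq: "on_U ?Z c \<noteq> c"
    have "on_U ?Z 0 = 0" using Z(2) by (simp add: fixes_poles_def on_U_def)
    then have c: "c \<noteq> 0" "c \<noteq> y" "c \<noteq> - y" using neq Zy Z_minus by auto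
    then have Zc: "on_U ?Z c = - c" using pm neq by blast
    \<comment> \<open>Z c = - c contradicts the sign rule at c + y, because Z y = y and neither c
      nor y has order 2.\<close>
    have cy: "c + y \<noteq> 0" "c + y \<noteq> y" using c by (auto simp: eq_neg_iff_add_eq_0)
    have "on_U ?Z (c + y) = - c + y" using on_U_add[OF Z, of c y] Zc Zy by simp
    then have "- c + y = c + y \<or> - c + y = - (c + y)" using pm[OF cy] by simp
    then have "c + c = 0 \<or> y + y = 0" by (auto simp: algebra_simps)
    then show False using two c y by blast
  qed
  show ?thesis
  proof
    fix u
    show "?Z u = id u"
      using on_U_Some[OF Zb] Zc Z(2) by (cases u) (auto simp: fixes_poles_def)
  qed
qed

end

section \<open>Consequences of involutivity\<close>

locale involutive_moufang = special_moufang +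
  assumes involution: "y \<noteq> 0 \<Longrightarrow> mu y \<circ> mu y = id"
begin

lemma mu_mu: "y \<noteq> 0 \<Longrightarrow> mu y (mu y u) = u"
  using involution pointfree_idE by metis

lemma mu_uminus: "y \<noteq> 0 \<Longrightarrow> mu (- y) = mu y"
  by (metis inv_mu inv_unique_comp involution)

lemma M_uminus: "y \<noteq> 0 \<Longrightarrow> M (- y) = M y"
  by (simp add: M_def mu_uminus)

lemma M_M: "y \<noteq> 0 \<Longrightarrow> x \<noteq> 0 \<Longrightarrow> M y (M y x) = x"
  using M_cancel(1) M_uminus by metis

lemma M_conj:
  assumes "a \<noteq> 0" "y \<noteq> 0" "x \<noteq> 0"
  shows "M (M a y) x = M a (M y (M a x))"
proof -
  have "perm_conj (mu y) (mu a) = mu (- M a y)"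
    using conj_mu_swapping[OF mu_in_N mu_swaps, OF assms(1,1,2)] M_odd[OF assms(1,2)] by (simp add: M_def)
  also have "\<dots> = mu (M a y)" using M_nonzero assms by (intro mu_uminus)
  finally have "mu (M a y) (mu a (Some (M a x))) = mu a (mu y (Some (M a x)))"
    using perm_conj_apply[OF mu_bij[OF assms(1)], of "mu y" "Some (M a x)"] by simp
  then show ?thesis using assms by (simp add: mu_Some M_nonzero M_M)
qed

text \<open>Expand \<open>M a y\<close> and then \<open>M (M a y) (- a)\<close> by \<open>M_formula\<close> with base \<open>a\<close>.\<close>

lemma M_sum:
  assumes a: "a \<noteq> 0" and y: "y \<noteq> 0" and ay: "a + y \<noteq> 0"
  shows "M a (a + y) - M y (a + y) = y - a"
proof -
  let ?m = "M a"
  define s where "s = a + y"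
  define c where "c = ?m y"
  have c: "c \<noteq> 0" "?m c = y" using M_nonzero M_M a y by (auto simp: c_def)
  have ca: "c - a \<noteq> 0"
  proof
    assume "c - a = 0"
    then have "y = - a" using c(2) M_self[OF a] by simp
    then show False using ay by simp
  qed
  have formula: "M b x = ?m (?m (x + b) - ?m b) + b" if "b \<noteq> 0" "x \<noteq> 0" "x + b \<noteq> 0" for b x
    using M_formula[OF a that] by (simp add: M_uminus[OF a])
  define d where "d = ?m s + a"
  have "c = ?m d + a"
    using formula[OF a y] ay M_self[OF a] by (simp add: c_def d_def s_def add.commute)
  then have md: "?m d = c - a" by simp
  have ms0: "?m s \<noteq> 0" using M_nonzero a ay s_def by blast
  have "d \<noteq> 0"
  proof
    assume "d = 0"
    then have "?m s = ?m a" unfolding M_self[OF a] by (simp add: d_def eq_neg_iff_add_eq_0)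
    then have "s = a" using M_M[OF a] a ay s_def by metis
    then show False using y by (simp add: s_def)
  qed
  then have d: "d = ?m (c - a)" using M_M[OF a] md by metis
  have na: "- a \<noteq> 0" using a by simp
  define z where "z = d - y"
  have "M c (- a) = ?m (?m (- a + c) - ?m c) + c"
    using ca by (intro formula[OF c(1) na]) simp
  then have Mc: "M c (- a) - c = ?m z" using d c(2) by (simp add: z_def)
  have z0: "z \<noteq> 0"
  proof
    assume "z = 0"
    then have "?m (c - a) = ?m c" using d c(2) by (simp add: z_def)
    then have "c - a = c" using M_M[OF a] ca c(1) by metis
    then show False using a by simp
  qed
  have "?m (- a) = a" using M_odd[OF a a] M_self[OF a] by simp
  then have 1: "M c (- a) = ?m (M y a)" using M_conj[OF a y na] by (simp add: c_def)
  have 2: "- c = ?m (M y y)" using M_self[OF y] M_odd[OF a y] by (simp add: c_def)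
  \<comment> \<open>A single \<open>M a\<close> is not additive in general, but the product of two
    \<open>mu\<close>-maps is. This merges the values at a and y into the one at s = a + y.\<close>
  define g where "g = mu a \<circ> mu y"
  have g: "g \<in> N" "fixes_poles g"
    unfolding g_def using N_comp[OF mu_in_N[OF a] mu_in_N[OF y]] swaps_comp[OF mu_swaps[OF a] mu_swaps[OF y]] by auto
  have gM: "on_U g x = ?m (M y x)" if "x \<noteq> 0" for x
    using that a y M_nonzero[OF y] by (simp add: g_def on_U_def mu_Some)
  have "?m z = M c (- a) + - c" using Mc by simp
  also have "\<dots> = ?m (M y a) + ?m (M y y)" unfolding 1 2 ..
  also have "\<dots> = ?m (M y s)"
    using on_U_add[OF g, of a y] gM[OF a] gM[OF y] gM[OF ay] by (simp add: s_def)
  finally have "?m z = ?m (M y s)" .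
  then have "z = M y s" using M_M[OF a] z0 M_nonzero[OF y ay] s_def by metis
  then have "?m s = M y s + y - a" by (simp add: z_def d_def algebra_simps)
  then show ?thesis by (simp add: s_def)
qed

section \<open>Hua maps\<close>

lemma on_U_\<tau>: "on_U \<tau> = M e"
  unfolding M_def using \<tau>_mu by simp

lemma hua_eq: "a \<noteq> 0 \<Longrightarrow> hua \<tau> a = on_U (mu a \<circ> \<tau>)"
  by (simp add: hua_def)

lemma hua_zero: "hua \<tau> 0 x = 0"
  by (simp add: hua_def)

lemma hua_map: "a \<noteq> 0 \<Longrightarrow> mu a \<circ> \<tau> \<in> N" "a \<noteq> 0 \<Longrightarrow> fixes_poles (mu a \<circ> \<tau>)"
  using N_comp[OF mu_in_N \<tau>_in_N] swaps_comp[OF mu_swaps \<tau>_swaps] by auto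

lemma hua_Some: "a \<noteq> 0 \<Longrightarrow> mu a (\<tau> (Some x)) = Some (hua \<tau> a x)"
  using on_U_Some[OF N_bij[OF hua_map(1)], of a x] hua_map(2) by (simp add: hua_eq)

lemma hua_M: "a \<noteq> 0 \<Longrightarrow> x \<noteq> 0 \<Longrightarrow> hua \<tau> a x = M a (M e x)"
  using hua_Some[of a x] on_U_Some[OF \<tau>_bij, of x] \<tau>_swaps M_nonzero[OF e_nonzero]
  by (simp add: on_U_\<tau> mu_Some)

lemma hua_additive: "Modules.additive (hua \<tau> a)"
proof (cases "a = 0")
  case False
  then show ?thesis
    unfolding hua_eq[OF False] by (intro additive.intro on_U_add hua_map)
qed (simp add: Modules.additive_def hua_zero)

lemma hua_bij: assumes a: "a \<noteq> 0" shows "bij (hua \<tau> a)"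
proof (rule bij_betw_byWitness[of _ "\<lambda>x. if x = 0 then 0 else M e (M a x)"])
  have h0: "hua \<tau> a 0 = 0" using additive.zero[OF hua_additive] .
  have nz: "hua \<tau> a x \<noteq> 0" if "x \<noteq> 0" for x
    using that a e_nonzero M_nonzero by (simp add: hua_M)
  show "\<forall>x\<in>UNIV. (if hua \<tau> a x = 0 then 0 else M e (M a (hua \<tau> a x))) = x"
  proof
    fix x
    show "(if hua \<tau> a x = 0 then 0 else M e (M a (hua \<tau> a x))) = x"
      using nz[of x] h0 a e_nonzero M_nonzero M_M by (cases "x = 0") (simp_all add: hua_M)
  qed
  show "\<forall>x\<in>UNIV. hua \<tau> a (if x = 0 then 0 else M e (M a x)) = x"
    using h0 a e_nonzero M_nonzero M_M by (auto simp: hua_M)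
qed auto

text \<open>The conjugation rule \<open>conj_mu_fixing\<close> for
  \<open>mu b \<circ> \<tau>\<close>, whose inverse is \<open>\<tau> \<circ> mu b\<close> because
  both factors are involutions.\<close>

lemma hua_fundamental: "hua \<tau> (hua \<tau> b a) x = hua \<tau> b (hua \<tau> a (hua \<tau> b x))"
proof (cases "a = 0 \<or> b = 0")
  case True
  then show ?thesis by (auto simp: hua_zero additive.zero[OF hua_additive])
next
  case False
  then have a: "a \<noteq> 0" and b: "b \<noteq> 0" by auto
  let ?g = "mu b \<circ> \<tau>"
  have nz: "hua \<tau> b a \<noteq> 0"
    using a b e_nonzero M_nonzero by (simp add: hua_M)
  have \<tau>\<tau>: "\<tau> (\<tau> u) = u" for u using mu_mu[OF e_nonzero] \<tau>_mu by metis
  have "perm_conj (mu a) ?g (?g (\<tau> (mu b (\<tau> (Some x))))) = ?g (mu a (\<tau> (mu b (\<tau> (Some x)))))"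
    by (rule perm_conj_apply[OF N_bij[OF hua_map(1)[OF b]]])
  then have "mu (hua \<tau> b a) (\<tau> (Some x)) = mu b (\<tau> (mu a (\<tau> (mu b (\<tau> (Some x))))))"
    using conj_mu_fixing[OF hua_map[OF b] a] by (simp add: hua_eq[OF b] \<tau>\<tau> mu_mu[OF b])
  then show ?thesis using nz a b by (simp add: hua_Some)
qed

lemma hua_uminus: "hua \<tau> (- a) = hua \<tau> a"
  by (cases "a = 0") (simp_all add: hua_eq mu_uminus)

lemma hua_unit: "hua \<tau> e x = x"
  using hua_M[OF e_nonzero, of x] M_M[OF e_nonzero, of x] additive.zero[OF hua_additive]
  by (cases "x = 0") auto

lemma hua_in_hua_subgroup: "a \<noteq> 0 \<Longrightarrow> \<exists>g\<in>hua_subgroup \<tau>. hua \<tau> a = on_U g"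
proof -
  assume a: "a \<noteq> 0"
  have "mu a \<circ> mu e \<in> hua_subgroup \<tau>"
    unfolding hua_subgroup_def using a e_nonzero by (intro generate.incl) auto
  moreover have "hua \<tau> a = on_U (mu a \<circ> mu e)" using hua_eq[OF a] \<tau>_mu by simp
  ultimately show ?thesis by blast
qed

text \<open>Since \<open>M e\<close> is an involution, \<open>hua \<tau> a (M e x)\<close> is
  \<open>M a x\<close> for nonzero a and x, so \<open>h_T\<close> and \<open>h_T_sum\<close> become
  \<open>M_self\<close> and \<open>M_sum\<close>.\<close>

lemma hua_system_hua:
  assumes K: "operator_field K" "K \<subseteq> carrier (End_H_ring \<tau>)"
    and "finite_dim_over K" and inf: "infinite (K \<inter> centroid \<tau>)"
  shows "hua_system K (hua \<tau>) (M e) e"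
proof -
  interpret operator_field K by (rule K(1))
  show ?thesis
  proof
    show "hua \<tau> a (k x) = k (hua \<tau> a x)" if "k \<in> K" for k a x
    proof (cases "a = 0")
      case False
      then obtain g where g: "g \<in> hua_subgroup \<tau>" "hua \<tau> a = on_U g" using hua_in_hua_subgroup by blast
      have "k \<circ> on_U g = on_U g \<circ> k" using that K(2) g(1) by (auto simp: End_H_ring_def)
      then show ?thesis unfolding g(2) by (metis comp_apply)
    qed (use that op_zero in \<open>simp add: hua_zero\<close>)
    have "K \<inter> centroid \<tau> \<subseteq> K \<inter> {k. \<forall>a x. hua \<tau> (k a) x = hua \<tau> a (k (k x))}"
      by (auto simp: centroid_def)
    then show "infinite (K \<inter> {k. \<forall>a x. hua \<tau> (k a) x = hua \<tau> a (k (k x))})"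
      using inf finite_subset by blast
    show "hua \<tau> a (M e a) = - a" if "a \<noteq> 0" for a
      using that M_nonzero[OF e_nonzero] M_M[OF e_nonzero] M_self by (simp add: hua_M)
    show "hua \<tau> a (M e (a + y)) - hua \<tau> y (M e (a + y)) = y - a"
      if "a \<noteq> 0" "y \<noteq> 0" "a + y \<noteq> 0" for a y
      using that M_nonzero[OF e_nonzero] M_M[OF e_nonzero] M_sum by (simp add: hua_M)
    show "hua \<tau> a (x + y) = hua \<tau> a x + hua \<tau> a y" for a x y
      by (rule additive.add[OF hua_additive])
  qed (use assms(3) e_nonzero hua_zero hua_bij hua_uminus hua_unit hua_fundamental M_nonzero M_M in auto)
qed

end

section \<open>From the subfield to the operator field\<close>

context special_moufang
begin

text \<open>Serves to place - k in End_H(U): it commutes with \<open>on_U g\<close> because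
  \<open>on_U g\<close> is additive.\<close>

lemma hua_subgroup_additive:
  assumes "g \<in> hua_subgroup \<tau>"
  shows "bij g \<and> fixes_poles g \<and> Modules.additive (on_U g)"
  using assms unfolding hua_subgroup_def
proof (induction rule: generate.induct)
  case one
  show ?case by (auto simp: BijGroup_def fixes_poles_def on_U_def Modules.additive_def bij_def inj_on_def)
next
  case (incl g)
  then obtain a b where g: "g = mu b \<circ> mu a" "a \<noteq> 0" "b \<noteq> 0" by auto
  have "g \<in> N" "fixes_poles g" unfolding g(1)
    using N_comp[OF mu_in_N mu_in_N] swaps_comp[OF mu_swaps mu_swaps] g(2,3) by auto
  then show ?case by (auto intro: N_bij additive.intro on_U_add)
next
  case (inv g)
  then obtain a b where g: "g = mu b \<circ> mu a" "a \<noteq> 0" "b \<noteq> 0" by auto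
  have "bij g" unfolding g(1) by (intro bij_comp mu_bij g)
  then have "inv\<^bsub>BijGroup UNIV\<^esub> g = inv_into UNIV g"
    by (subst inv_BijGroup) (simp_all add: Bij_def restrict_UNIV)
  also have "\<dots> = inv_into UNIV (mu a) \<circ> inv_into UNIV (mu b)"
    unfolding g(1) using mu_bij g by (intro o_inv_distrib) auto
  also have "\<dots> = mu (- a) \<circ> mu (- b)" using g by (simp add: inv_mu)
  finally have eq: "inv\<^bsub>BijGroup UNIV\<^esub> g = mu (- a) \<circ> mu (- b)" .
  have "inv\<^bsub>BijGroup UNIV\<^esub> g \<in> N" "fixes_poles (inv\<^bsub>BijGroup UNIV\<^esub> g)" unfolding eq
    using N_comp[OF mu_in_N mu_in_N] swaps_comp[OF mu_swaps mu_swaps] g(2,3) by auto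
  then show ?case by (auto intro: N_bij additive.intro on_U_add)
next
  case (eng f g)
  then have eq: "f \<otimes>\<^bsub>BijGroup UNIV\<^esub> g = f \<circ> g"
    by (auto simp: BijGroup_def Bij_def compose_def)
  have "on_U (f \<circ> g) = on_U f \<circ> on_U g"
    using on_U_Some[of g] eng by (auto simp: on_U_def fun_eq_iff)
  then have "Modules.additive (on_U (f \<circ> g))" using eng by (simp add: Modules.additive_def)
  moreover have "bij (f \<circ> g)" using eng by (intro bij_comp) auto
  moreover have "fixes_poles (f \<circ> g)" using eng by (simp add: fixes_poles_def)
  ultimately show ?case unfolding eq by blast
qed

lemma operator_field_subfield:
  assumes K: "subfield K (End_H_ring \<tau>)"
  shows "operator_field K"
proof -
  let ?R = "End_H_ring \<tau>"
  interpret K: subfield K ?R by (rule K)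
  have carr: "K \<subseteq> carrier ?R" using K.subset by simp
  have inv: "\<exists>l\<in>K. \<forall>x. l (k x) = x" if "k \<in> K" "k \<noteq> (\<lambda>_. 0)" for k
  proof -
    have "k \<in> Units (?R\<lparr>carrier := K\<rparr>)" using that K.subfield_Units by (simp add: End_H_ring_def)
    then obtain l where "l \<in> K" "l \<circ> k = id" unfolding Units_def by (auto simp: End_H_ring_def)
    then show ?thesis by (metis comp_apply id_apply)
  qed
  have minus: "(\<lambda>x. - k x) \<in> K" if k: "k \<in> K" for k
  proof -
    have kR: "Modules.additive k" "\<And>g. g \<in> hua_subgroup \<tau> \<Longrightarrow> k \<circ> on_U g = on_U g \<circ> k"
      using k carr by (auto simp: End_H_ring_def)
    have "Modules.additive (\<lambda>x. - k x)" using kR(1) by (simp add: Modules.additive_def)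
    moreover have "(\<lambda>x. - k x) \<circ> on_U g = on_U g \<circ> (\<lambda>x. - k x)" if g: "g \<in> hua_subgroup \<tau>" for g
      using fun_cong[OF kR(2)[OF g]] additive.minus[of "on_U g"] hua_subgroup_additive[OF g]
      by (auto simp: fun_eq_iff)
    ultimately have carr': "(\<lambda>x. - k x) \<in> carrier ?R" by (simp add: End_H_ring_def)
    \<comment> \<open>Closure of \<open>K\<close> under additive inverses speaks of a definite
      description in the record, which has to be identified with pointwise negation.\<close>
    have "inv\<^bsub>add_monoid ?R\<^esub> k = (\<lambda>x. - k x)"
      unfolding m_inv_def
    proof (rule the_equality)
      show "(\<lambda>x. - k x) \<in> carrier (add_monoid ?R) \<and>
          k \<otimes>\<^bsub>add_monoid ?R\<^esub> (\<lambda>x. - k x) = \<one>\<^bsub>add_monoid ?R\<^esub> \<and>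
          (\<lambda>x. - k x) \<otimes>\<^bsub>add_monoid ?R\<^esub> k = \<one>\<^bsub>add_monoid ?R\<^esub>"
        using carr' by (simp add: End_H_ring_def)
      fix y assume "y \<in> carrier (add_monoid ?R) \<and>
          k \<otimes>\<^bsub>add_monoid ?R\<^esub> y = \<one>\<^bsub>add_monoid ?R\<^esub> \<and> y \<otimes>\<^bsub>add_monoid ?R\<^esub> k = \<one>\<^bsub>add_monoid ?R\<^esub>"
      then have "(\<lambda>x. k x + y x) = (\<lambda>_. 0)" by (simp add: End_H_ring_def)
      then have "k x + y x = 0" for x by meson
      then show "y = (\<lambda>x. - k x)" by (metis (no_types, lifting) ext minus_unique)
    qed
    then show ?thesis using K.m_inv_closed[OF k] by simp
  qed
  show ?thesis
  proof
    show "k (x + y) = k x + k y" if "k \<in> K" for k x y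
      using that carr additive.add[of k] by (auto simp: End_H_ring_def)
    show "id \<in> K" using K.one_closed by (simp add: End_H_ring_def)
    show "(\<lambda>_. 0) \<in> K" using K.subgroup_axioms subgroup.one_closed by (fastforce simp: End_H_ring_def)
    show "(\<lambda>x. k x + l x) \<in> K" if "k \<in> K" "l \<in> K" for k l
      using subgroup.m_closed[OF K.subgroup_axioms that] by (simp add: End_H_ring_def)
    show "k \<circ> l \<in> K" if "k \<in> K" "l \<in> K" for k l
      using submonoid.m_closed[OF K.submonoid_axioms that(2,1)] by (simp add: End_H_ring_def)
    show "k (l x) = l (k x)" if "k \<in> K" "l \<in> K" for k l x
      using fun_cong[OF K.sub_m_comm[OF that, unfolded End_H_ring_def, simplified], of x] by simp
  qed (use minus inv in auto)
qed

end

theorem theorem1: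
  fixes \<tau> :: "'a::ab_group_add option \<Rightarrow> 'a option"
    and e :: 'a
    and K :: "('a \<Rightarrow> 'a) set"
  assumes "interchanges_0_infty \<tau>"
    and "moufang_set (root_group \<tau>)"
    and "special \<tau>"
    and "e \<noteq> 0"
    and "\<tau> = mu_map \<tau> e"
    and "subfield K (End_H_ring \<tau>)"
    and "finite_dim_over K"
    and "infinite (K \<inter> centroid \<tau>)"
    and "generates_module (End_H_ring \<tau>) {hua \<tau> a e | a. a \<noteq> 0}"
    and "\<exists>l. l \<in> K - {\<lambda>_. 0} \<and> l \<in> centroid \<tau> \<and>
           (\<lambda>x. l x - x) \<in> K - {\<lambda>_. 0} \<and> (\<lambda>x. l x - x) \<in> centroid \<tau>"
  shows "(torsion_free_uniquely_divisible TYPE('a) \<and>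
            quadratic_jordan_division_algebra rat_field (scaled_group rat_scale) (hua \<tau>) e)
       \<or> (\<exists>p::int. prime p \<and> elementary_abelian p TYPE('a) \<and>
            quadratic_jordan_division_algebra (residue_ring p) (scaled_group int_scale) (hua \<tau>) e)"
proof -
  interpret special_moufang \<tau> e using assms(1-5) by unfold_locales
  interpret operator_field K using assms(6) by (rule operator_field_subfield)
  \<comment> \<open>Involutivity becomes available only here, since its proof needs the dichotomy
    for doubling supplied by \<open>K\<close>.\<close>
  interpret involutive_moufang \<tau> e
    using mu_involution[OF two_torsion_cases] by unfold_locales
  have "K \<subseteq> carrier (End_H_ring \<tau>)"
    using assms(6) by (auto simp: subfield_def subdomain_def subcring_def subring_def dest!: submonoid.subset)
  then interpret hua_system K "hua \<tau>" "M e" e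
    using assms(7,8) operator_field_axioms by (intro hua_system_hua)
  show ?thesis
    using characteristic_cases e_nonzero rational_jordan modular_jordan by blast
qed

end
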